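(* Let $k$ be a nonnegative integer and let $\mathcal H$ be a complex Hilbert space with $\dim\mathcal H=N\ge 2(k+1)$, where $N$ could be infinite. Let $\mathbf A=(A_1,A_2,A_3,A_4)$ with $$A_1=X\oplus0_{N-2},\quad A_2=Y\oplus0_{N-2},\quad A_3=Z\oplus0_{N-2},\quad A_4=0_2\oplus I_k\oplus(-I_{N-k-2}),$$ where $X,Y,Z$ are the Pauli matrices. Then $W_{k+1}(\mathbf A)$ is not convex. Moreover, for positive integers $r$ not larger than $\dim\mathcal H$: (1) If $r\le k$, then $W_r(\mathbf A)$ is convex and equals $$\{(a,b,c,d)\in\mathbb R^4:\ \xi=\sqrt{a^2+b^2+c^2}\le1,\ \xi+|d|\le r\}.$$ (2) If $k+1<r$ and $2r$ is not larger than $N$, then $W_r(\mathbf A)$ is convex and equals $$\{(a,b,c,d)\in\mathbb R^4:\ \xi=\sqrt{a^2+b^2+c^2}\le1\ \text{ and }\ -r\le d-\xi\le 2k-r+1\}.$$ (3) If $N$ is finite and $r\ge N/2$, then $W_r(\mathbf A)=(0,0,0,2k+2-N)-W_{N-r}(\mathbf A)$, so that $W_r(\mathbf A)$ is convex except for $r=N-k-1$.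
   Context: For an $m$-tuple $\mathbf A=(A_1,\dots,A_m)$ of bounded operators on $\mathcal H$ and a positive integer $r\le\dim\mathcal H$, the joint $r$-numerical range is $$W_r(\mathbf A)=\Big\{\Big(\sum_{\ell=1}^r\langle A_1x_\ell,x_\ell\rangle,\dots,\sum_{\ell=1}^r\langle A_mx_\ell,x_\ell\rangle\Big):\{x_1,\dots,x_r\}\subseteq\mathcal H\text{ orthonormal}\Big\},$$ and $W_0(\mathbf A)=\{(0,\dots,0)\}$. The Pauli matrices are $$X=\begin{pmatrix}0&1\\1&0\end{pmatrix},\quad Y=\begin{pmatrix}0&-i\\i&0\end{pmatrix},\quad Z=\begin{pmatrix}1&0\\0&-1\end{pmatrix}.$$ $I_p$ and $0_p$ are the identity and zero operators on a space of dimension $p$ (with $N-2$ and $N-k-2$ read as the infinite dimension $N$ if $N$ is infinite); all direct sums are taken relative to one fixed orthogonal decomposition of $\mathcal H$ into subspaces of dimensions $2$, $k$, $N-k-2$.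
   Formalization: In item (2) the printed upper bound d−ξ ≤ 2k−r+1 is false, since (0,0,0,2k−r+2) always lies in W_r(A); it is replaced by d+ξ ≤ 2k−r+2, while the lower bound −r ≤ d−ξ and ξ ≤ 1 are kept. *)

theory Defs
  imports "HOL-Analysis.Analysis" "HOL-Library.Extended_Nat"
begin

section \<open>Complex Hilbert spaces\<close>

text \<open>
  The libraries only provide real inner product spaces.  A complex Hilbert space is a complete real
  inner product space together with a complex scalar multiplication and a complex inner product
  (linear in the first argument) whose real part is the given real inner product; positive
  definiteness and the formula for the norm are inherited from the real structure.
\<close>

class complex_hilbert_space = banach + real_inner +
  fixes scaleC :: "complex \<Rightarrow> 'a \<Rightarrow> 'a"  (infixr "*\<^sub>C" 75)
    and cinner :: "'a \<Rightarrow> 'a \<Rightarrow> complex"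
  assumes scaleC_add_right: "c *\<^sub>C (x + y) = c *\<^sub>C x + c *\<^sub>C y"
    and scaleC_add_left: "(c + d) *\<^sub>C x = c *\<^sub>C x + d *\<^sub>C x"
    and scaleC_scaleC: "c *\<^sub>C (d *\<^sub>C x) = (c * d) *\<^sub>C x"
    and scaleC_of_real: "complex_of_real t *\<^sub>C x = t *\<^sub>R x"
    and cinner_commute: "cinner x y = cnj (cinner y x)"
    and cinner_add_left: "cinner (x + y) z = cinner x z + cinner y z"
    and cinner_scaleC_left: "cinner (c *\<^sub>C x) y = c * cinner x y"
    and Re_cinner: "Re (cinner x y) = inner x y"

lemma vector_space_scaleC:
  "vector_space (scaleC :: complex \<Rightarrow> 'a \<Rightarrow> 'a :: complex_hilbert_space)"
  by unfold_locales
    (simp_all add: scaleC_add_right scaleC_add_left scaleC_scaleC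
      scaleC_of_real[of 1, simplified])

interpretation complex_vector:
  vector_space "scaleC :: complex \<Rightarrow> 'a \<Rightarrow> 'a :: complex_hilbert_space"
  by (rule vector_space_scaleC)

lemma cinner_self: "cinner x x = complex_of_real ((norm x)\<^sup>2)"
  for x :: "'a :: complex_hilbert_space"
proof (rule complex_eqI)
  show "Re (cinner x x) = Re (complex_of_real ((norm x)\<^sup>2))"
    by (simp add: Re_cinner power2_norm_eq_inner)
  have "Im (cinner x x) = - Im (cinner x x)"
    by (subst cinner_commute) simp
  then show "Im (cinner x x) = Im (complex_of_real ((norm x)\<^sup>2))"
    by simp
qed

definition orthonormal_family :: "'i set \<Rightarrow> ('i \<Rightarrow> 'a :: complex_hilbert_space) \<Rightarrow> bool" where
  "orthonormal_family I x \<longleftrightarrow>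
     (\<forall>i\<in>I. \<forall>j\<in>I. cinner (x i) (x j) = (if i = j then 1 else 0))"

definition orthonormal_basis ::
    "'i set \<Rightarrow> ('i \<Rightarrow> 'a :: complex_hilbert_space) \<Rightarrow> 'a set \<Rightarrow> bool" where
  "orthonormal_basis I x S \<longleftrightarrow>
     orthonormal_family I x \<and> closure (complex_vector.span (x ` I)) = S"

text \<open>
  The Hilbert dimension is the cardinality of an orthonormal basis, where all infinite
  cardinalities are identified with \<open>\<infinity>\<close>.  In particular \<open>\<infinity> - n = \<infinity>\<close> in \<open>enat\<close>.
\<close>

definition has_hilbert_dim :: "'a :: complex_hilbert_space set \<Rightarrow> enat \<Rightarrow> bool" where
  "has_hilbert_dim S n \<longleftrightarrow>
     (\<exists>B. orthonormal_basis B (\<lambda>b. b) S \<and> n = (if finite B then enat (card B) else \<infinity>))"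


section \<open>Orthogonal direct sums\<close>

definition orthogonal_decomposition ::
    "'a :: complex_hilbert_space set \<Rightarrow> 'a set \<Rightarrow> 'a set \<Rightarrow> bool" where
  "orthogonal_decomposition H1 H2 H3 \<longleftrightarrow>
     (\<forall>S\<in>{H1, H2, H3}. complex_vector.subspace S \<and> closed S) \<and>
     (\<forall>x\<in>H1. \<forall>y\<in>H2. cinner x y = 0) \<and>
     (\<forall>x\<in>H1. \<forall>z\<in>H3. cinner x z = 0) \<and>
     (\<forall>y\<in>H2. \<forall>z\<in>H3. cinner y z = 0) \<and>
     (\<forall>v. \<exists>x\<in>H1. \<exists>y\<in>H2. \<exists>z\<in>H3. v = x + y + z)"

text \<open>
  \<open>T\<close> is \<open>T1 \<oplus> T2 \<oplus> T3\<close>, where only the restriction of \<open>Ti\<close> to \<open>Hi\<close> matters.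
  For an orthogonal decomposition this determines \<open>T\<close>.
\<close>

definition is_direct_sum ::
    "'a :: complex_hilbert_space set \<Rightarrow> 'a set \<Rightarrow> 'a set \<Rightarrow>
     ('a \<Rightarrow> 'a) \<Rightarrow> ('a \<Rightarrow> 'a) \<Rightarrow> ('a \<Rightarrow> 'a) \<Rightarrow> ('a \<Rightarrow> 'a) \<Rightarrow> bool" where
  "is_direct_sum H1 H2 H3 T T1 T2 T3 \<longleftrightarrow>
     (\<forall>x\<in>H1. \<forall>y\<in>H2. \<forall>z\<in>H3. T (x + y + z) = T1 x + T2 y + T3 z)"

text \<open>The operator with matrix \<open>M\<close> in the orthonormal basis \<open>u\<close> of its domain.\<close>

definition matrix_operator ::
    "complex^'n^'n \<Rightarrow> ('n \<Rightarrow> 'a) \<Rightarrow> 'a \<Rightarrow> 'a :: complex_hilbert_space" where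
  "matrix_operator M u x = (\<Sum>i\<in>UNIV. (\<Sum>j\<in>UNIV. M $ i $ j * cinner x (u j)) *\<^sub>C u i)"

definition pauli_X :: "complex^2^2" where
  "pauli_X = vector [vector [0, 1], vector [1, 0]]"

definition pauli_Y :: "complex^2^2" where
  "pauli_Y = vector [vector [0, - \<i>], vector [\<i>, 0]]"

definition pauli_Z :: "complex^2^2" where
  "pauli_Z = vector [vector [1, 0], vector [0, - 1]]"


section \<open>Joint numerical ranges\<close>

definition joint_numerical_range ::
    "nat \<Rightarrow> ('m \<Rightarrow> 'a \<Rightarrow> 'a :: complex_hilbert_space) \<Rightarrow> (complex^'m) set" where
  "joint_numerical_range r A =
     {(\<chi> j. \<Sum>l<r. cinner (A j (x l)) (x l)) | x. orthonormal_family {..<r} x}"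

lemma joint_numerical_range_0: "joint_numerical_range 0 A = {0}"
  by (auto simp: joint_numerical_range_def orthonormal_family_def vec_eq_iff)

text \<open>\<open>\<real>\<^sup>4\<close> as a subset of \<open>\<complex>\<^sup>4\<close>.\<close>

definition real_point :: "real \<Rightarrow> real \<Rightarrow> real \<Rightarrow> real \<Rightarrow> complex^4" where
  "real_point a b c d = vector [of_real a, of_real b, of_real c, of_real d]"

lemma real_point_nth:
  "real_point a b c d $ 1 = of_real a" "real_point a b c d $ 2 = of_real b"
  "real_point a b c d $ 3 = of_real c" "real_point a b c d $ 4 = of_real d"
  by (simp_all add: real_point_def vector_def)

text \<open>
  Deviation from the source.  For \<open>k + 1 < r\<close> and \<open>2 * r \<le> N\<close> the source prints the condition
  \<open>- r \<le> d - \<xi> \<le> 2 * k - r + 1\<close>, where \<open>\<xi> = sqrt (a\<^sup>2 + b\<^sup>2 + c\<^sup>2)\<close>; the statement here has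
  \<open>- r \<le> d - \<xi>\<close> and \<open>d + \<xi> \<le> 2 * k - r + 2\<close>.  The printed upper bound is false: it fails at \<open>x\<^sub>1, \<dots>, x\<^sub>r\<close> spanning
  the two-dimensional summand, the \<open>k\<close>-dimensional summand and \<open>r - k - 2\<close> directions of the third
  one, which gives \<open>(0, 0, 0, 2 * k - r + 2)\<close>; and the printed region contains
  \<open>(\<plusminus>1, 0, 0, 2 * k - r + 2)\<close> but not their midpoint, so that it is not convex.
  The bound used here comes from \<open>d = 2 * s + t - r\<close>, where \<open>t \<in> {\<xi>..2 - \<xi>}\<close> and \<open>s \<in> {0..k}\<close> are
  the traces of the compressions of the rank \<open>r\<close> projection to the first two summands.
\<close>

end

(*
  Write P for the projection onto the span of x_1, ..., x_r, let C be its compression to the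
  two-dimensional summand, t = tr C, and s the trace of its compression to the k-dimensional one.
  The first three coordinates form the Bloch vector of C, whose length xi is the difference of the
  two eigenvalues of C, so that 0 <= C <= 1 gives xi <= t <= 2 - xi; the last coordinate is
  2 s + t - r with 0 <= s <= k and s + t <= r.  Conversely, vectors sqrt p y + sqrt (1 - p) z that
  mix orthonormal vectors of different summands realise every point allowed by these inequalities
  when r <= k or k + 1 < r <= N / 2.

  For r = k + 1 a last coordinate k forces s = k and t = 1, so that the range of P contains the
  second summand and one unit vector of the first.  Then xi = 1, and the points (0, 0, 1, k),
  (0, 0, -1, k) of the range have a midpoint outside of it.  For finite N the complementary
  projection gives W_r = tr A - W_{N-r}.
*)
theory Submission
  imports Defs
begin

section \<open>Complex inner products and orthonormal families\<close>

lemma cinner_add_right: "cinner x (y + z) = cinner x y + cinner x z"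
  for x :: "'a :: complex_hilbert_space"
  by (metis cinner_commute cinner_add_left complex_cnj_add)

lemma cinner_scaleC_right: "cinner x (c *\<^sub>C y) = cnj c * cinner x y"
  for x :: "'a :: complex_hilbert_space"
  by (metis cinner_commute cinner_scaleC_left complex_cnj_mult)

lemma cinner_zero_left [simp]: "cinner 0 x = 0"
  for x :: "'a :: complex_hilbert_space"
  using cinner_add_left[of 0 0 x] by simp

lemma cinner_zero_right [simp]: "cinner x 0 = 0"
  for x :: "'a :: complex_hilbert_space"
  using cinner_add_right[of x 0 0] by simp

lemma cinner_minus_left: "cinner (- x) y = - cinner x y"
  for x :: "'a :: complex_hilbert_space"
  using cinner_add_left[of x "- x" y] by (simp add: add_eq_0_iff)

lemma cinner_minus_right: "cinner x (- y) = - cinner x y"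
  for x :: "'a :: complex_hilbert_space"
  using cinner_add_right[of x y "- y"] by (simp add: add_eq_0_iff)

lemma cinner_diff_left: "cinner (x - y) z = cinner x z - cinner y z"
  for x :: "'a :: complex_hilbert_space"
  using cinner_add_left[of x "- y" z] by (simp add: cinner_minus_left)

lemma cinner_diff_right: "cinner x (y - z) = cinner x y - cinner x z"
  for x :: "'a :: complex_hilbert_space"
  using cinner_add_right[of x y "- z"] by (simp add: cinner_minus_right)

lemma cinner_sum_left: "cinner (\<Sum>i\<in>I. x i) y = (\<Sum>i\<in>I. cinner (x i) y)"
  for y :: "'a :: complex_hilbert_space"
  by (induction I rule: infinite_finite_induct) (simp_all add: cinner_add_left)

lemma cinner_sum_right: "cinner y (\<Sum>i\<in>I. x i) = (\<Sum>i\<in>I. cinner y (x i))"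
  for y :: "'a :: complex_hilbert_space"
  by (induction I rule: infinite_finite_induct) (simp_all add: cinner_add_right)

lemma cinner_scaleR_left: "cinner (t *\<^sub>R x) y = complex_of_real t * cinner x y"
  for x :: "'a :: complex_hilbert_space"
  by (metis cinner_scaleC_left scaleC_of_real)

lemma cinner_scaleR_right: "cinner x (t *\<^sub>R y) = complex_of_real t * cinner x y"
  for x :: "'a :: complex_hilbert_space"
  by (metis cinner_scaleC_right scaleC_of_real complex_cnj_complex_of_real)

lemma cmod_cinner_commute: "cmod (cinner x y) = cmod (cinner y x)"
  for x :: "'a :: complex_hilbert_space"
  by (metis cinner_commute complex_mod_cnj)

lemma cinner_eq_0_commute: "cinner x y = 0 \<longleftrightarrow> cinner y x = 0"
  for x :: "'a :: complex_hilbert_space"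
  by (metis cinner_commute complex_cnj_zero)

text \<open>Multiplying the second argument by \<open>\<i>\<close> multiplies the value by
  \<open>- \<i>\<close>, which moves the imaginary part into the real part.\<close>

lemma cinner_eq_Complex: "cinner x y = Complex (inner x y) (inner x (\<i> *\<^sub>C y))"
  for x :: "'a :: complex_hilbert_space"
  by (simp add: complex_eq_iff Re_cinner[symmetric] cinner_scaleC_right)

lemma scaleC_eq_scaleR: "c *\<^sub>C x = Re c *\<^sub>R x + Im c *\<^sub>R (\<i> *\<^sub>C x)"
  for x :: "'a :: complex_hilbert_space"
proof -
  have "c *\<^sub>C x = (of_real (Re c) + of_real (Im c) * \<i>) *\<^sub>C x"
    by (simp add: complex_eq mult.commute)
  then show ?thesis
    by (simp only: scaleC_add_left scaleC_of_real scaleC_scaleC[symmetric])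
qed

text \<open>Splitting into real and imaginary parts reduces this to continuity of the real inner
  product. It serves to show that the vectors equal to their finite expansion form a closed
  set.\<close>

lemma continuous_on_cinner_scaleC: "continuous_on S (\<lambda>x. cinner x y *\<^sub>C z)"
  for y z :: "'a :: complex_hilbert_space"
  by (subst scaleC_eq_scaleR) (auto simp: cinner_eq_Complex intro!: continuous_intros)

section \<open>Orthonormal families, Bessel and Parseval\<close>

lemma orthonormal_familyD:
  assumes "orthonormal_family I x" "i \<in> I" "j \<in> I"
  shows "cinner (x i) (x j) = (if i = j then 1 else 0)"
  using assms by (simp add: orthonormal_family_def)

lemma orthonormal_family_norm:
  assumes "orthonormal_family I x" "i \<in> I"
  shows "norm (x i) = 1"
proof -
  have "complex_of_real ((norm (x i))\<^sup>2) = 1"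
    unfolding cinner_self[symmetric] using orthonormal_familyD[OF assms assms(2)] by simp
  then have "(norm (x i))\<^sup>2 = 1"
    using of_real_eq_1_iff by blast
  then show ?thesis
    by (simp add: power2_eq_1_iff) (smt (verit) norm_ge_zero)
qed

lemma orthonormal_family_subset:
  assumes "orthonormal_family I x" "J \<subseteq> I"
  shows "orthonormal_family J x"
  using assms unfolding orthonormal_family_def by blast

lemma orthonormal_family_reindex:
  assumes "orthonormal_family I x" "inj_on h J" "h ` J \<subseteq> I"
  shows "orthonormal_family J (\<lambda>j. x (h j))"
  using assms unfolding orthonormal_family_def inj_on_def by (auto simp: image_subset_iff)

text \<open>The Gram-Schmidt remainder: for a finite orthonormal family, the component of
  \<open>v\<close> orthogonal to its span.\<close>

definition residual :: "'i set \<Rightarrow> ('i \<Rightarrow> 'a) \<Rightarrow> 'a \<Rightarrow> 'a :: complex_hilbert_space" where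
  "residual I x v = v - (\<Sum>i\<in>I. cinner v (x i) *\<^sub>C x i)"

lemma cinner_sum_orthonormal:
  assumes "orthonormal_family I x" "finite I" "j \<in> I"
  shows "cinner (\<Sum>i\<in>I. c i *\<^sub>C x i) (x j) = c j"
proof -
  have "cinner (\<Sum>i\<in>I. c i *\<^sub>C x i) (x j) = (\<Sum>i\<in>I. if i = j then c i else 0)"
    unfolding cinner_sum_left cinner_scaleC_left
    by (rule sum.cong) (use assms in \<open>auto simp: orthonormal_familyD[OF assms(1)]\<close>)
  then show ?thesis
    using assms by simp
qed

lemma cinner_residual:
  assumes "orthonormal_family I x" "finite I" "j \<in> I"
  shows "cinner (residual I x v) (x j) = 0"
  by (simp add: residual_def cinner_diff_left cinner_sum_orthonormal[OF assms])

text \<open>The remainder is orthogonal to every \<open>x i\<close>, so pairing it with itself is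
  the same as pairing it with \<open>v\<close>. Bessel's inequality, its equality case and
  Parseval's identity are all read off from this formula.\<close>

lemma norm_residual:
  assumes "orthonormal_family I x" "finite I"
  shows "(norm (residual I x v))\<^sup>2 = (norm v)\<^sup>2 - (\<Sum>i\<in>I. (cmod (cinner v (x i)))\<^sup>2)"
proof -
  have "cinner (residual I x v) (residual I x v) = cinner (residual I x v) v"
    using cinner_residual[OF assms]
    by (subst (2) residual_def)
      (simp add: cinner_diff_right cinner_sum_right cinner_scaleC_right)
  also have "\<dots> = cinner v v - (\<Sum>i\<in>I. cinner v (x i) * cnj (cinner v (x i)))"
    by (simp add: residual_def cinner_diff_left cinner_sum_left cinner_scaleC_left
        flip: cinner_commute)
  finally have "complex_of_real ((norm (residual I x v))\<^sup>2) =
      complex_of_real ((norm v)\<^sup>2 - (\<Sum>i\<in>I. (cmod (cinner v (x i)))\<^sup>2))"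
    unfolding cinner_self complex_norm_square[symmetric] by simp
  then show ?thesis
    using of_real_eq_iff by blast
qed

lemma bessel:
  assumes "orthonormal_family I x" "finite I"
  shows "(\<Sum>i\<in>I. (cmod (cinner v (x i)))\<^sup>2) \<le> (norm v)\<^sup>2"
  using norm_residual[OF assms, of v] zero_le_power2[of "norm (residual I x v)"] by linarith

lemma bessel':
  assumes "orthonormal_family I x" "finite I"
  shows "(\<Sum>i\<in>I. (cmod (cinner (x i) v))\<^sup>2) \<le> (norm v)\<^sup>2"
  using bessel[OF assms] by (simp add: cmod_cinner_commute)

lemma bessel_eqD:
  assumes "orthonormal_family I x" "finite I"
    and "(\<Sum>i\<in>I. (cmod (cinner v (x i)))\<^sup>2) = (norm v)\<^sup>2"
  shows "v = (\<Sum>i\<in>I. cinner v (x i) *\<^sub>C x i)"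
  using norm_residual[OF assms(1,2), of v] assms(3) by (simp add: residual_def)

text \<open>The vectors that agree with their expansion form a closed subspace containing every
  \<open>x i\<close>, hence they include the closure of the span.\<close>

lemma orthonormal_basis_expand:
  assumes "orthonormal_basis I x S" "finite I" "v \<in> S"
  shows "v = (\<Sum>i\<in>I. cinner v (x i) *\<^sub>C x i)"
proof -
  have on: "orthonormal_family I x"
    using assms(1) by (simp add: orthonormal_basis_def)
  define E where "E = {v. v = (\<Sum>i\<in>I. cinner v (x i) *\<^sub>C x i)}"
  have "closed E"
    unfolding E_def
    by (intro closed_Collect_eq continuous_on_sum continuous_on_cinner_scaleC continuous_on_id)
  moreover have "complex_vector.span (x ` I) \<subseteq> E"
  proof (rule complex_vector.span_minimal)
    show "x ` I \<subseteq> E"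
    proof
      fix y assume "y \<in> x ` I"
      then obtain j where j: "j \<in> I" "y = x j" by blast
      have "(\<Sum>i\<in>I. cinner (x j) (x i) *\<^sub>C x i) = (\<Sum>i\<in>I. if i = j then x j else 0)"
        using j by (intro sum.cong) (auto simp: orthonormal_familyD[OF on])
      then show "y \<in> E"
        using j assms(2) by (simp add: E_def)
    qed
    show "complex_vector.subspace E"
    proof (rule complex_vector.subspaceI)
      fix v w assume "v \<in> E" "w \<in> E"
      then show "v + w \<in> E"
        unfolding E_def mem_Collect_eq cinner_add_left scaleC_add_left sum.distrib by argo
    next
      fix c v assume "v \<in> E"
      then show "c *\<^sub>C v \<in> E"
        unfolding E_def mem_Collect_eq cinner_scaleC_left scaleC_scaleC[symmetric]
          complex_vector.scale_sum_right[symmetric]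
        by (rule arg_cong)
    qed (simp add: E_def)
  qed
  ultimately have "closure (complex_vector.span (x ` I)) \<subseteq> E"
    by (rule closure_minimal[rotated])
  then show ?thesis
    using assms by (auto simp: orthonormal_basis_def E_def)
qed

lemma parseval:
  assumes "orthonormal_basis I x S" "finite I" "v \<in> S"
  shows "(\<Sum>i\<in>I. (cmod (cinner v (x i)))\<^sup>2) = (norm v)\<^sup>2"
proof -
  have "orthonormal_family I x"
    using assms(1) by (simp add: orthonormal_basis_def)
  from norm_residual[OF this assms(2), of v] show ?thesis
    using orthonormal_basis_expand[OF assms] by (simp add: residual_def)
qed

section \<open>Extending orthonormal families up to the Hilbert dimension\<close>

lemma orthonormal_family_Suc:
  assumes "orthonormal_family {..<m} x" "\<And>i. i < m \<Longrightarrow> cinner v (x i) = 0" "norm v = 1"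
  shows "orthonormal_family {..<Suc m} (x(m := v))"
  unfolding orthonormal_family_def
proof (intro ballI)
  fix i j assume "i \<in> {..<Suc m}" "j \<in> {..<Suc m}"
  then show "cinner ((x(m := v)) i) ((x(m := v)) j) = (if i = j then 1 else 0)"
    using assms(2)[of i] assms(2)[of j] assms(3)
    by (auto simp: less_Suc_eq orthonormal_familyD[OF assms(1)] cinner_self[of v]
        cinner_eq_0_commute[of _ v])
qed

lemma orthonormal_family_residual:
  assumes "orthonormal_family {..<m} x" "residual {..<m} x b \<noteq> 0"
  obtains v where "orthonormal_family {..<Suc m} (x(m := v))"
proof (rule that[OF orthonormal_family_Suc[OF assms(1)]])
  let ?v = "residual {..<m} x b"
  show "norm ((1 / norm ?v) *\<^sub>R ?v) = 1"
    using assms(2) by simp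
  show "cinner ((1 / norm ?v) *\<^sub>R ?v) (x i) = 0" if "i < m" for i
    using that cinner_residual[OF assms(1)] by (simp add: cinner_scaleR_left)
qed

text \<open>Double counting: if \<open>m + 1\<close> basis vectors all lay in the span of the
  \<open>m\<close> vectors \<open>x i\<close>, the sum of all squared coefficients would be
  \<open>m + 1\<close> summed one way and, by Bessel, at most \<open>m\<close> summed the other way.
  So some basis vector has a nonzero remainder, which is normalised and appended.\<close>

lemma orthonormal_extend_Suc:
  fixes x :: "nat \<Rightarrow> 'a :: complex_hilbert_space"
  assumes dim: "has_hilbert_dim (UNIV :: 'a set) N"
    and x: "orthonormal_family {..<m} x" and m: "enat m < N"
  obtains v where "orthonormal_family {..<Suc m} (x(m := v))"
proof -
  obtain B :: "'a set" where B: "orthonormal_family B (\<lambda>b. b)"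
    and N: "N = (if finite B then enat (card B) else \<infinity>)"
    using dim by (auto simp: has_hilbert_dim_def orthonormal_basis_def)
  obtain C where C: "C \<subseteq> B" "finite C" "card C = Suc m"
    using N m infinite_arbitrarily_large[of B "Suc m"] obtain_subset_with_card_n[of "Suc m" B]
    by (cases "finite B") (auto simp: Suc_le_eq)
  have onC: "orthonormal_family C (\<lambda>b. b)"
    using B C by (blast intro: orthonormal_family_subset)
  have "\<exists>b\<in>C. residual {..<m} x b \<noteq> 0"
  proof (rule ccontr)
    assume "\<not> ?thesis"
    then have "(\<Sum>i<m. (cmod (cinner b (x i)))\<^sup>2) = 1" if "b \<in> C" for b
      using norm_residual[OF x finite_lessThan, of b] that orthonormal_family_norm[OF onC that]
      by simp
    then have "real (Suc m) = (\<Sum>b\<in>C. \<Sum>i<m. (cmod (cinner b (x i)))\<^sup>2)"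
      using C by simp
    also have "\<dots> = (\<Sum>i<m. \<Sum>b\<in>C. (cmod (cinner b (x i)))\<^sup>2)"
      by (rule sum.swap)
    also have "\<dots> \<le> (\<Sum>i<m. (norm (x i))\<^sup>2)"
      by (intro sum_mono bessel'[OF onC C(2)])
    also have "\<dots> = real m"
      using orthonormal_family_norm[OF x] by simp
    finally show False by simp
  qed
  then show thesis
    using orthonormal_family_residual[OF x] that by blast
qed

lemma orthonormal_extend:
  fixes x :: "nat \<Rightarrow> 'a :: complex_hilbert_space"
  assumes dim: "has_hilbert_dim (UNIV :: 'a set) N"
    and x: "orthonormal_family {..<j} x" and m: "enat m \<le> N" "j \<le> m"
  obtains y where "orthonormal_family {..<m} y" "\<And>i. i < j \<Longrightarrow> y i = x i"
proof -
  have "\<exists>y. orthonormal_family {..<m} y \<and> (\<forall>i<j. y i = x i)"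
    using m(2,1)
  proof (induction m rule: dec_induct)
    case base
    then show ?case using x by blast
  next
    case (step m)
    then have lt: "enat m < N"
      by (metis Suc_ile_eq)
    then obtain y where y: "orthonormal_family {..<m} y" "\<forall>i<j. y i = x i"
      using step.IH by force
    obtain v where "orthonormal_family {..<Suc m} (y(m := v))"
      using orthonormal_extend_Suc[OF dim y(1) lt] .
    moreover have "\<forall>i<j. (y(m := v)) i = x i"
      using y(2) step.hyps by simp
    ultimately show ?case by blast
  qed
  then show thesis using that by blast
qed

text \<open>The same double count: Parseval in the finite basis gives \<open>m\<close>, Bessel
  against the family \<open>x\<close> gives at most \<open>n\<close>.\<close>

lemma orthonormal_family_card_le:
  fixes x :: "nat \<Rightarrow> 'a :: complex_hilbert_space"
  assumes dim: "has_hilbert_dim (UNIV :: 'a set) (enat n)"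
    and x: "orthonormal_family {..<m} x"
  shows "m \<le> n"
proof -
  obtain B :: "'a set" where B: "orthonormal_basis B (\<lambda>b. b) UNIV" "finite B" "card B = n"
    using dim by (auto simp: has_hilbert_dim_def split: if_splits)
  then have onB: "orthonormal_family B (\<lambda>b. b)"
    by (simp add: orthonormal_basis_def)
  have "real m = (\<Sum>i<m. \<Sum>b\<in>B. (cmod (cinner (x i) b))\<^sup>2)"
    using parseval[OF B(1,2)] orthonormal_family_norm[OF x] by simp
  also have "\<dots> = (\<Sum>b\<in>B. \<Sum>i<m. (cmod (cinner (x i) b))\<^sup>2)"
    by (rule sum.swap)
  also have "\<dots> \<le> (\<Sum>b\<in>B. (norm b)\<^sup>2)"
    by (intro sum_mono bessel'[OF x]) simp
  also have "\<dots> = real n"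
    using orthonormal_family_norm[OF onB] B(3) by simp
  finally show ?thesis by simp
qed

text \<open>A nonzero remainder could be normalised and appended, giving \<open>n + 1\<close>
  orthonormal vectors in dimension \<open>n\<close>.\<close>

lemma orthonormal_family_complete:
  fixes x :: "nat \<Rightarrow> 'a :: complex_hilbert_space"
  assumes dim: "has_hilbert_dim (UNIV :: 'a set) (enat n)"
    and x: "orthonormal_family {..<n} x"
  shows "v = (\<Sum>i<n. cinner v (x i) *\<^sub>C x i)"
proof (rule ccontr)
  assume "v \<noteq> (\<Sum>i<n. cinner v (x i) *\<^sub>C x i)"
  then have "residual {..<n} x v \<noteq> 0"
    by (simp add: residual_def)
  then obtain w where "orthonormal_family {..<Suc n} (x(n := w))"
    using orthonormal_family_residual[OF x] by blast
  from orthonormal_family_card_le[OF dim this] show False by simp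
qed

section \<open>The joint numerical range in coordinates\<close>

lemma real_point_eq_iff:
  "real_point a b c d = real_point a' b' c' d' \<longleftrightarrow> a = a' \<and> b = b' \<and> c = c' \<and> d = d'"
  by (auto simp: vec_eq_iff forall_4 real_point_nth)

lemma real_point_add:
  "real_point a b c d + real_point a' b' c' d' = real_point (a + a') (b + b') (c + c') (d + d')"
  by (simp add: vec_eq_iff forall_4 real_point_nth)

lemma real_point_scaleR:
  "t *\<^sub>R real_point a b c d = real_point (t * a) (t * b) (t * c) (t * d)"
  unfolding vec_eq_iff forall_4 vector_scaleR_component real_point_nth
  by (simp add: scaleR_conv_of_real)

lemma real_point_zero: "real_point 0 0 0 0 = 0"
  by (simp add: vec_eq_iff forall_4 real_point_nth)

lemma real_point_sum:
  "(\<Sum>i\<in>I. real_point (a i) (b i) (c i) (d i)) =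
     real_point (\<Sum>i\<in>I. a i) (\<Sum>i\<in>I. b i) (\<Sum>i\<in>I. c i) (\<Sum>i\<in>I. d i)"
  by (induction I rule: infinite_finite_induct) (simp_all add: real_point_zero real_point_add)

text \<open>
  \<open>e 0, e 1\<close> stand for the basis of the first summand and \<open>e 2, \<dots>, e (k + 1)\<close> for one of the
  second, so that the third summand is the orthogonal complement and needs no coordinates.
\<close>

definition pauli_value ::
    "(nat \<Rightarrow> 'a) \<Rightarrow> nat \<Rightarrow> 'a :: complex_hilbert_space \<Rightarrow> complex^4" where
  "pauli_value e k v = real_point
     (2 * Re (cnj (cinner v (e 0)) * cinner v (e 1)))
     (2 * Im (cnj (cinner v (e 0)) * cinner v (e 1)))
     ((cmod (cinner v (e 0)))\<^sup>2 - (cmod (cinner v (e 1)))\<^sup>2)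
     (2 * (\<Sum>i<k+2. (cmod (cinner v (e i)))\<^sup>2)
       - (cmod (cinner v (e 0)))\<^sup>2 - (cmod (cinner v (e 1)))\<^sup>2 - (norm v)\<^sup>2)"

definition pauli_range ::
    "(nat \<Rightarrow> 'a :: complex_hilbert_space) \<Rightarrow> nat \<Rightarrow> nat \<Rightarrow> (complex^4) set" where
  "pauli_range e k r = {\<Sum>l<r. pauli_value e k (x l) | x. orthonormal_family {..<r} x}"

lemma pauli_rangeI:
  assumes "orthonormal_family {..<r} x" "w = (\<Sum>l<r. pauli_value e k (x l))"
  shows "w \<in> pauli_range e k r"
  using assms unfolding pauli_range_def by blast

section \<open>Values on frame vectors and on mixtures\<close>

lemma pauli_value_cong:
  assumes "\<And>i. i < k + 2 \<Longrightarrow> e i = e' i"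
  shows "pauli_value e k = pauli_value e' k"
  using assms by (simp add: pauli_value_def fun_eq_iff)

text \<open>From index \<open>k + 2\<close> on, a frame vector is orthogonal to
  \<open>e 0, ..., e (k + 1)\<close>, so only the norm term \<open>- 1\<close> survives. Such
  vectors play the part of directions in the third summand.\<close>

lemma pauli_value_frame:
  assumes "orthonormal_family {..<k+2+m} e" "2 \<le> j" "j < k + 2 + m"
  shows "pauli_value e k (e j) = real_point 0 0 0 (if j < k + 2 then 1 else - 1)"
proof -
  have "(\<Sum>i<k+2. (cmod (cinner (e j) (e i)))\<^sup>2) = (\<Sum>i<k+2. if i = j then 1 else 0)"
    using assms by (intro sum.cong) (auto simp: orthonormal_familyD[OF assms(1)])
  moreover have "cinner (e j) (e 0) = 0" "cinner (e j) (e 1) = 0" "norm (e j) = 1"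
    using assms orthonormal_family_norm[OF assms(1), of j]
    by (auto simp: orthonormal_familyD[OF assms(1)])
  ultimately show ?thesis
    by (simp add: pauli_value_def)
qed

lemma norm_add_orthogonal:
  fixes x y :: "'a :: complex_hilbert_space"
  assumes "cinner x y = 0"
  shows "(norm (x + y))\<^sup>2 = (norm x)\<^sup>2 + (norm y)\<^sup>2"
proof -
  have "inner x y = 0"
    using assms by (simp flip: Re_cinner)
  then show ?thesis
    by (simp add: power2_norm_eq_inner inner_add_left inner_add_right inner_commute)
qed

text \<open>No coordinate \<open>e i\<close> sees both \<open>y\<close> and \<open>z\<close>, and
  \<open>z\<close> has no component in the first summand. Hence all cross terms vanish, and the
  squared coefficients \<open>p\<close> and \<open>1 - p\<close> make the value affine in
  \<open>p\<close>.\<close>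

lemma pauli_value_mix:
  assumes p: "0 \<le> p" "p \<le> 1" and yz: "cinner y z = 0"
    and "\<And>i. i < k + 2 \<Longrightarrow> cinner y (e i) = 0 \<or> cinner z (e i) = 0"
    and z: "cinner z (e 0) = 0" "cinner z (e 1) = 0"
  shows "pauli_value e k (sqrt p *\<^sub>R y + sqrt (1 - p) *\<^sub>R z) =
    p *\<^sub>R pauli_value e k y + (1 - p) *\<^sub>R pauli_value e k z"
proof -
  let ?v = "sqrt p *\<^sub>R y + sqrt (1 - p) *\<^sub>R z"
  have v: "cinner ?v (e i) =
      of_real (sqrt p) * cinner y (e i) + of_real (sqrt (1 - p)) * cinner z (e i)" for i
    by (simp add: cinner_add_left cinner_scaleR_left)
  have "(cmod (cinner ?v (e i)))\<^sup>2 =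
      p * (cmod (cinner y (e i)))\<^sup>2 + (1 - p) * (cmod (cinner z (e i)))\<^sup>2" if "i < k + 2" for i
    using assms(4)[OF that] p by (auto simp: v norm_mult power_mult_distrib)
  then have "(\<Sum>i<k+2. (cmod (cinner ?v (e i)))\<^sup>2) =
      p * (\<Sum>i<k+2. (cmod (cinner y (e i)))\<^sup>2) + (1 - p) * (\<Sum>i<k+2. (cmod (cinner z (e i)))\<^sup>2)"
    unfolding sum_distrib_left sum.distrib[symmetric] by (intro sum.cong) simp_all
  moreover have "(cmod (cinner ?v (e i)))\<^sup>2 = p * (cmod (cinner y (e i)))\<^sup>2" if "i = 0 \<or> i = 1" for i
    using that p z by (auto simp: v norm_mult power_mult_distrib)
  moreover have "cnj (cinner ?v (e 0)) * cinner ?v (e 1) =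
      of_real p * (cnj (cinner y (e 0)) * cinner y (e 1))"
  proof -
    have "of_real p = complex_of_real (sqrt p) * of_real (sqrt p)"
      using p(1) by (metis of_real_mult real_sqrt_mult_self abs_of_nonneg)
    then show ?thesis
      by (simp only: v z complex_cnj_mult complex_cnj_add complex_cnj_complex_of_real) simp
  qed
  moreover have "(norm ?v)\<^sup>2 = p * (norm y)\<^sup>2 + (1 - p) * (norm z)\<^sup>2"
    using p yz by (subst norm_add_orthogonal)
      (auto simp: cinner_scaleR_left cinner_scaleR_right power_mult_distrib)
  ultimately show ?thesis
    unfolding pauli_value_def real_point_scaleR real_point_add real_point_eq_iff
    using z by (auto simp: algebra_simps)
qed

text \<open>Conditions on \<open>y i\<close> are imposed only where \<open>p i\<close> is nonzero.
  This allows \<open>y\<close> to be constant when a single weight is nonzero, and allows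
  \<open>y\<close> and \<open>z\<close> to be taken from one frame with overlapping indices.\<close>

lemma orthonormal_family_mix:
  assumes p: "\<And>i. i \<in> I \<Longrightarrow> 0 \<le> p i \<and> p i \<le> 1"
    and y: "orthonormal_family {i\<in>I. p i \<noteq> 0} y" and z: "orthonormal_family I z"
    and yz: "\<And>i j. i \<in> I \<Longrightarrow> j \<in> I \<Longrightarrow> p i \<noteq> 0 \<Longrightarrow> cinner (y i) (z j) = 0"
  shows "orthonormal_family I (\<lambda>i. sqrt (p i) *\<^sub>R y i + sqrt (1 - p i) *\<^sub>R z i)"
  unfolding orthonormal_family_def
proof (intro ballI)
  fix i j assume ij: "i \<in> I" "j \<in> I"
  have eq: "cinner (sqrt (p i) *\<^sub>R y i + sqrt (1 - p i) *\<^sub>R z i)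
      (sqrt (p j) *\<^sub>R y j + sqrt (1 - p j) *\<^sub>R z j) =
      of_real (sqrt (p i) * sqrt (p j)) * cinner (y i) (y j) +
      of_real (sqrt (p i) * sqrt (1 - p j)) * cinner (y i) (z j) +
      of_real (sqrt (1 - p i) * sqrt (p j)) * cinner (z i) (y j) +
      of_real (sqrt (1 - p i) * sqrt (1 - p j)) * cinner (z i) (z j)"
    by (simp add: cinner_add_left cinner_add_right cinner_scaleR_left cinner_scaleR_right
        algebra_simps)
  have a: "of_real (sqrt (p i) * sqrt (p j)) * cinner (y i) (y j) = of_real (if i = j then p i else 0)"
    using ij p[OF ij(1)] y by (cases "p i = 0 \<or> p j = 0")
      (auto simp: orthonormal_family_def simp flip: of_real_mult)
  have b: "of_real (sqrt (p i) * sqrt (1 - p j)) * cinner (y i) (z j) = 0"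
    using yz[OF ij] by auto
  have c: "of_real (sqrt (1 - p i) * sqrt (p j)) * cinner (z i) (y j) = 0"
    using yz[OF ij(2,1)] by (auto simp: cinner_eq_0_commute[of "z i"])
  have d: "of_real (sqrt (1 - p i) * sqrt (1 - p j)) * cinner (z i) (z j) =
      of_real (if i = j then 1 - p i else 0)"
    using ij p[OF ij(1)] z by (auto simp: orthonormal_family_def simp flip: of_real_mult)
  show "cinner (sqrt (p i) *\<^sub>R y i + sqrt (1 - p i) *\<^sub>R z i)
      (sqrt (p j) *\<^sub>R y j + sqrt (1 - p j) *\<^sub>R z j) = (if i = j then 1 else 0)"
    unfolding eq a b c d by simp
qed

section \<open>The Bloch sphere and rotations of the first summand\<close>

text \<open>Surjectivity of the Hopf map from unit vectors of \<complex>^2 to the sphere. Taking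
  \<alpha> real and positive leads to \<alpha> = (1 + c) / s and \<beta> = (a + i b) / s with s =
  sqrt (2 (1 + c)). At the pole c = -1 this s vanishes, so the vector (0, 1) is used there.\<close>

lemma bloch_parameters:
  fixes a b c :: real
  assumes "a\<^sup>2 + b\<^sup>2 + c\<^sup>2 = 1"
  obtains \<alpha> \<beta> :: complex where "(cmod \<alpha>)\<^sup>2 + (cmod \<beta>)\<^sup>2 = 1" "2 * Re (cnj \<alpha> * \<beta>) = a"
    "2 * Im (cnj \<alpha> * \<beta>) = b" "(cmod \<alpha>)\<^sup>2 - (cmod \<beta>)\<^sup>2 = c"
proof (cases "c = - 1")
  case True
  then have "a = 0" "b = 0"
    using assms by (simp_all add: sum_power2_eq_zero_iff)
  then show thesis
    using True by (intro that[of 0 1]) simp_all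
next
  case False
  have "c\<^sup>2 \<le> 1\<^sup>2"
    using assms zero_le_power2[of a] zero_le_power2[of b] unfolding power_one by linarith
  then have "- 1 \<le> c"
    using abs_le_square_iff[of c 1] by simp
  then have pos: "1 + c > 0"
    using False by simp
  define s where "s = sqrt (2 * (1 + c))"
  have s: "s * s = 2 * (1 + c)" "s \<noteq> 0"
    using pos by (simp_all add: s_def)
  have ab: "a * a + b * b = (1 - c) * (1 + c)"
    using assms by (simp add: power2_eq_square algebra_simps)
  let ?\<alpha> = "complex_of_real ((1 + c) / s)" and ?\<beta> = "Complex (a / s) (b / s)"
  have "(cmod ?\<alpha>)\<^sup>2 = (1 + c) * (1 + c) / (s * s)"
    unfolding norm_of_real power2_abs by (simp add: power2_eq_square)
  then have 1: "(cmod ?\<alpha>)\<^sup>2 = (1 + c) / 2"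
    unfolding s using mult_divide_mult_cancel_right[of "1 + c" "1 + c" 2] pos by linarith
  have "(cmod ?\<beta>)\<^sup>2 = (a * a + b * b) / (s * s)"
    unfolding cmod_power2 by (simp add: power2_eq_square add_divide_distrib)
  then have 2: "(cmod ?\<beta>)\<^sup>2 = (1 - c) / 2"
    unfolding ab s using mult_divide_mult_cancel_right[of "1 + c" "1 - c" 2] pos by linarith
  have 3: "2 * ((1 + c) / s * (a / s)) = a" "2 * ((1 + c) / s * (b / s)) = b"
    using pos s by (simp_all add: field_simps)
  show thesis
  proof (rule that)
    show "(cmod ?\<alpha>)\<^sup>2 + (cmod ?\<beta>)\<^sup>2 = 1" "(cmod ?\<alpha>)\<^sup>2 - (cmod ?\<beta>)\<^sup>2 = c"
      unfolding 1 2 by (simp_all add: field_simps)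
    show "2 * Re (cnj ?\<alpha> * ?\<beta>) = a" "2 * Im (cnj ?\<alpha> * ?\<beta>) = b"
      by (simp_all only: complex_cnj_complex_of_real times_complex.sel complex.sel
          Re_complex_of_real Im_complex_of_real mult_zero_left diff_zero add_0_right 3)
  qed
qed

text \<open>The matrix with columns (\<alpha>, \<beta>) and (- cnj \<beta>, cnj \<alpha>) lies in
  SU(2), and its columns are eigenvectors of a X + b Y + c Z for the eigenvalues 1 and -1. The last
  identity writes the quadratic form of that matrix in the eigenbasis; the one before it holds
  because both pairs span the same plane.\<close>

lemma bloch_frame:
  fixes e :: "nat \<Rightarrow> 'a :: complex_hilbert_space"
  assumes e: "orthonormal_family {..<k+2+m} e" and abc: "a\<^sup>2 + b\<^sup>2 + c\<^sup>2 = 1"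
  obtains f where "orthonormal_family {..<k+2+m} f" "\<And>i. 2 \<le> i \<Longrightarrow> f i = e i"
    "pauli_value e k (f 0) = real_point a b c 0"
    "pauli_value e k (f 1) = real_point (- a) (- b) (- c) 0"
    "\<And>v. (cmod (cinner v (f 0)))\<^sup>2 + (cmod (cinner v (f 1)))\<^sup>2 =
      (cmod (cinner v (e 0)))\<^sup>2 + (cmod (cinner v (e 1)))\<^sup>2"
    "\<And>v. (cmod (cinner v (f 0)))\<^sup>2 - (cmod (cinner v (f 1)))\<^sup>2 =
      a * (2 * Re (cnj (cinner v (e 0)) * cinner v (e 1))) +
      b * (2 * Im (cnj (cinner v (e 0)) * cinner v (e 1))) +
      c * ((cmod (cinner v (e 0)))\<^sup>2 - (cmod (cinner v (e 1)))\<^sup>2)"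
proof -
  obtain \<alpha> \<beta> :: complex where norm: "(cmod \<alpha>)\<^sup>2 + (cmod \<beta>)\<^sup>2 = 1" and
    a: "2 * Re (cnj \<alpha> * \<beta>) = a" and b: "2 * Im (cnj \<alpha> * \<beta>) = b" and
    c: "(cmod \<alpha>)\<^sup>2 - (cmod \<beta>)\<^sup>2 = c"
    using bloch_parameters[OF abc] .
  define f where "f = e(0 := \<alpha> *\<^sub>C e 0 + \<beta> *\<^sub>C e 1, 1 := - cnj \<beta> *\<^sub>C e 0 + cnj \<alpha> *\<^sub>C e 1)"
  have f0: "f 0 = \<alpha> *\<^sub>C e 0 + \<beta> *\<^sub>C e 1" and f1: "f 1 = - cnj \<beta> *\<^sub>C e 0 + cnj \<alpha> *\<^sub>C e 1"
    and f2: "\<And>i. 2 \<le> i \<Longrightarrow> f i = e i"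
    by (simp_all add: f_def)
  note ee = orthonormal_familyD[OF e]
  have n: "\<alpha> * cnj \<alpha> + \<beta> * cnj \<beta> = 1"
    using norm by (metis complex_norm_square of_real_1 of_real_add of_real_power)
  have v0: "cinner (f 0) (e i) = (if i = 0 then \<alpha> else if i = 1 then \<beta> else 0)"
    and v1: "cinner (f 1) (e i) = (if i = 0 then - cnj \<beta> else if i = 1 then cnj \<alpha> else 0)"
    if "i < k + 2 + m" for i
    unfolding f0 f1 cinner_add_left cinner_scaleC_left
    using that ee[of 0 i] ee[of 1 i] by auto
  have w0: "cinner v (f 0) = cnj \<alpha> * cinner v (e 0) + cnj \<beta> * cinner v (e 1)"
    and w1: "cinner v (f 1) = - \<beta> * cinner v (e 0) + \<alpha> * cinner v (e 1)" for v
    unfolding f0 f1 cinner_add_right cinner_scaleC_right by simp_all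
  have f: "orthonormal_family {..<k+2+m} f"
    unfolding orthonormal_family_def
  proof (intro ballI)
    fix i j assume ij: "i \<in> {..<k+2+m}" "j \<in> {..<k+2+m}"
    consider "i = 0" | "i = 1" | "2 \<le> i" by linarith
    then show "cinner (f i) (f j) = (if i = j then 1 else 0)"
    proof cases
      case 1
      consider "j = 0" | "j = 1" | "2 \<le> j" by linarith
      then show ?thesis
      proof cases
        case 3
        then show ?thesis using 1 ij v0[of j] by (simp add: f2)
      qed (use 1 n v0[of 0] v0[of 1] in \<open>simp_all add: w0[simplified] w1[simplified] algebra_simps\<close>)
    next
      case 2
      consider "j = 0" | "j = 1" | "2 \<le> j" by linarith
      then show ?thesis
      proof cases
        case 3
        then show ?thesis using 2 ij v1[of j] by (simp add: f2)
      qed (use 2 n v1[of 0] v1[of 1] in \<open>simp_all add: w0[simplified] w1[simplified] algebra_simps\<close>)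
    next
      case 3
      consider "j = 0" | "j = 1" | "2 \<le> j" by linarith
      then show ?thesis
        by cases (use 3 ij in \<open>auto simp: w0[simplified] w1[simplified] f2 ee\<close>)
    qed
  qed
  have n0: "norm (f 0) = 1" and n1: "norm (f 1) = 1"
    by (rule orthonormal_family_norm[OF f]; simp)+
  have s0: "(\<Sum>i<k+2. (cmod (cinner (f 0) (e i)))\<^sup>2) = 1"
  proof -
    have "(\<Sum>i<k+2. (cmod (cinner (f 0) (e i)))\<^sup>2) = (\<Sum>i\<in>{0,1}. (cmod (cinner (f 0) (e i)))\<^sup>2)"
      by (rule sum.mono_neutral_right) (auto simp: v0)
    then show ?thesis using norm by (simp add: v0)
  qed
  have s1: "(\<Sum>i<k+2. (cmod (cinner (f 1) (e i)))\<^sup>2) = 1"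
  proof -
    have "(\<Sum>i<k+2. (cmod (cinner (f 1) (e i)))\<^sup>2) = (\<Sum>i\<in>{0,1}. (cmod (cinner (f 1) (e i)))\<^sup>2)"
      by (rule sum.mono_neutral_right) (auto simp: v1[simplified])
    then show ?thesis using norm by (simp add: v1[simplified] add.commute)
  qed
  show thesis
  proof (rule that[OF f f2])
    show "pauli_value e k (f 0) = real_point a b c 0"
      unfolding pauli_value_def real_point_eq_iff s0 n0
      using norm a b c by (simp add: v0)
    show "pauli_value e k (f 1) = real_point (- a) (- b) (- c) 0"
      unfolding pauli_value_def real_point_eq_iff s1 n1
      using norm a b c by (simp add: v1[simplified] algebra_simps)
    fix v
    \<comment> \<open>In real and imaginary parts both identities become polynomial. The first uses
      the normalisation of \<alpha> and \<beta>, the second holds identically once a, b, c are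
      expressed by them.\<close>
    obtain p q r s t u w z where
      x: "cinner v (e 0) = Complex p q" "cinner v (e 1) = Complex r s" "\<alpha> = Complex t u" "\<beta> = Complex w z"
      by (metis complex.exhaust_sel)
    have n': "t\<^sup>2 + u\<^sup>2 + w\<^sup>2 + z\<^sup>2 = 1"
      using norm by (simp add: x cmod_power2)
    have "(cmod (cinner v (f 0)))\<^sup>2 + (cmod (cinner v (f 1)))\<^sup>2 =
        (t\<^sup>2 + u\<^sup>2 + w\<^sup>2 + z\<^sup>2) * (p\<^sup>2 + q\<^sup>2 + r\<^sup>2 + s\<^sup>2)"
      unfolding w0 w1 x cmod_power2 by (simp add: power2_eq_square algebra_simps)
    then show "(cmod (cinner v (f 0)))\<^sup>2 + (cmod (cinner v (f 1)))\<^sup>2 =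
      (cmod (cinner v (e 0)))\<^sup>2 + (cmod (cinner v (e 1)))\<^sup>2"
      unfolding n' x cmod_power2 by simp
    show "(cmod (cinner v (f 0)))\<^sup>2 - (cmod (cinner v (f 1)))\<^sup>2 =
      a * (2 * Re (cnj (cinner v (e 0)) * cinner v (e 1))) +
      b * (2 * Im (cnj (cinner v (e 0)) * cinner v (e 1))) +
      c * ((cmod (cinner v (e 0)))\<^sup>2 - (cmod (cinner v (e 1)))\<^sup>2)"
      unfolding w0 w1 a[symmetric] b[symmetric] c[symmetric] x cmod_power2
      by (simp add: power2_eq_square algebra_simps)
  qed
qed

lemma sum_lessThan_plus2:
  "(\<Sum>i<k+2. g i) = g 0 + g 1 + (\<Sum>i<k. g (i + 2))"
  for g :: "nat \<Rightarrow> 'b :: comm_monoid_add"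
  by (simp add: sum.lessThan_Suc_shift add.assoc del: sum.lessThan_Suc)

text \<open>The zero vector gets the direction (1, 0, 0), which spares later arguments a case
  distinction on \<xi> = 0.\<close>

lemma unit_direction:
  fixes a b c :: real
  obtains a' b' c' where "a'\<^sup>2 + b'\<^sup>2 + c'\<^sup>2 = 1" "a = sqrt (a\<^sup>2 + b\<^sup>2 + c\<^sup>2) * a'"
    "b = sqrt (a\<^sup>2 + b\<^sup>2 + c\<^sup>2) * b'" "c = sqrt (a\<^sup>2 + b\<^sup>2 + c\<^sup>2) * c'"
proof (cases "a\<^sup>2 + b\<^sup>2 + c\<^sup>2 = 0")
  case True
  then have "a = 0 \<and> b = 0 \<and> c = 0"
    by (metis add_nonneg_eq_0_iff sum_power2_ge_zero zero_le_power2 zero_eq_power2)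
  then show thesis
    by (intro that[of 1 0 0]) auto
next
  case False
  define \<xi> where "\<xi> = sqrt (a\<^sup>2 + b\<^sup>2 + c\<^sup>2)"
  have \<xi>: "\<xi>\<^sup>2 = a\<^sup>2 + b\<^sup>2 + c\<^sup>2" "\<xi> \<noteq> 0"
    using False by (simp_all add: \<xi>_def)
  have "(a / \<xi>)\<^sup>2 + (b / \<xi>)\<^sup>2 + (c / \<xi>)\<^sup>2 = \<xi>\<^sup>2 / \<xi>\<^sup>2"
    unfolding power_divide add_divide_distrib[symmetric] \<xi>(1)[symmetric] ..
  then show thesis
    using \<xi>(2) by (intro that[of "a / \<xi>" "b / \<xi>" "c / \<xi>"]) (simp_all flip: \<xi>_def)
qed

section \<open>Inequalities satisfied by every point of the range\<close>

text \<open>In the frame of the first summand rotated to the direction of the Bloch vector, the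
  quadratic form \<open>T\<close> of the projection takes two values in [0, 1] with sum
  \<open>t\<close> and difference \<xi>, which bounds \<xi> by \<open>t\<close> and by
  \<open>2 - t\<close>. The bounds on \<open>s\<close> and on \<open>s + t\<close> are Bessel's
  inequality against the family \<open>x\<close> and against the frame \<open>e\<close>,
  respectively.\<close>

lemma pauli_range_bounds:
  assumes e: "orthonormal_family {..<k+2} e" and w: "w \<in> pauli_range e k r"
  obtains a b c s t where "w = real_point a b c (2 * s + t - real r)"
    "sqrt (a\<^sup>2 + b\<^sup>2 + c\<^sup>2) \<le> t" "sqrt (a\<^sup>2 + b\<^sup>2 + c\<^sup>2) \<le> 2 - t"
    "0 \<le> s" "s \<le> real k" "s + t \<le> real r"
proof -
  obtain x where x: "orthonormal_family {..<r} x" and w: "w = (\<Sum>l<r. pauli_value e k (x l))"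
    using w by (auto simp: pauli_range_def)
  define T where "T v = (\<Sum>l<r. (cmod (cinner (x l) v))\<^sup>2)" for v
  define s where "s = (\<Sum>i<k. T (e (i + 2)))"
  define t where "t = T (e 0) + T (e 1)"
  define a where "a = (\<Sum>l<r. 2 * Re (cnj (cinner (x l) (e 0)) * cinner (x l) (e 1)))"
  define b where "b = (\<Sum>l<r. 2 * Im (cnj (cinner (x l) (e 0)) * cinner (x l) (e 1)))"
  define c where "c = (\<Sum>l<r. (cmod (cinner (x l) (e 0)))\<^sup>2 - (cmod (cinner (x l) (e 1)))\<^sup>2)"
  have T: "0 \<le> T v" "T v \<le> (norm v)\<^sup>2" for v
    unfolding T_def by (simp_all add: sum_nonneg bessel'[OF x])
  have st: "s + t = (\<Sum>l<r. \<Sum>i<k+2. (cmod (cinner (x l) (e i)))\<^sup>2)"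
    unfolding sum_lessThan_plus2 sum.distrib s_def t_def T_def sum.swap[of _ "{..<r}" "{..<k}"]
    by (simp only: add.commute)
  have "w = real_point a b c (2 * (s + t) - T (e 0) - T (e 1) - (\<Sum>l<r. (norm (x l))\<^sup>2))"
    unfolding w pauli_value_def real_point_sum st a_def b_def c_def T_def
    by (simp only: sum_subtractf sum_distrib_left)
  then have w': "w = real_point a b c (2 * s + t - real r)"
    using orthonormal_family_norm[OF x] by (simp add: t_def algebra_simps)
  have "s + t \<le> (\<Sum>l<r. (norm (x l))\<^sup>2)"
    unfolding st by (intro sum_mono bessel[OF e]) simp
  then have str: "s + t \<le> real r"
    using orthonormal_family_norm[OF x] by simp
  have "s \<le> (\<Sum>i<k. 1)"
    unfolding s_def
  proof (rule sum_mono)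
    fix i assume "i \<in> {..<k}"
    then show "T (e (i + 2)) \<le> 1"
      using T(2)[of "e (i + 2)"] orthonormal_family_norm[OF e, of "i + 2"] by simp
  qed
  then have s: "0 \<le> s" "s \<le> real k"
    by (simp_all add: s_def T sum_nonneg)
  define \<xi> where "\<xi> = sqrt (a\<^sup>2 + b\<^sup>2 + c\<^sup>2)"
  obtain a' b' c' where unit: "a'\<^sup>2 + b'\<^sup>2 + c'\<^sup>2 = 1" and
    abc: "a = \<xi> * a'" "b = \<xi> * b'" "c = \<xi> * c'"
    unfolding \<xi>_def by (rule unit_direction)
  have e0: "orthonormal_family {..<k+2+0} e"
    using e by simp
  obtain f where f: "orthonormal_family {..<k+2+0} f" and
    plus: "\<And>v. (cmod (cinner v (f 0)))\<^sup>2 + (cmod (cinner v (f 1)))\<^sup>2 =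
      (cmod (cinner v (e 0)))\<^sup>2 + (cmod (cinner v (e 1)))\<^sup>2" and
    minus: "\<And>v. (cmod (cinner v (f 0)))\<^sup>2 - (cmod (cinner v (f 1)))\<^sup>2 =
      a' * (2 * Re (cnj (cinner v (e 0)) * cinner v (e 1))) +
      b' * (2 * Im (cnj (cinner v (e 0)) * cinner v (e 1))) +
      c' * ((cmod (cinner v (e 0)))\<^sup>2 - (cmod (cinner v (e 1)))\<^sup>2)"
    using bloch_frame[OF e0 unit] by metis
  have "T (f 0) + T (f 1) = t"
    unfolding T_def t_def sum.distrib[symmetric] plus ..
  \<comment> \<open>Pairing the Bloch vector with its own unit direction gives its length
    \<xi>.\<close>
  moreover have "T (f 0) - T (f 1) = a' * a + b' * b + c' * c"
    unfolding T_def sum_subtractf[symmetric] minus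
    unfolding sum.distrib sum_distrib_left[symmetric] a_def b_def c_def ..
  then have "T (f 0) - T (f 1) = \<xi> * (a'\<^sup>2 + b'\<^sup>2 + c'\<^sup>2)"
    unfolding abc by (simp add: power2_eq_square algebra_simps)
  moreover have "T (f i) \<le> 1" if "i < 2" for i
    using T(2)[of "f i"] orthonormal_family_norm[OF f, of i] that by simp
  from this[of 0] this[of 1] have "T (f 0) \<le> 1" "T (f 1) \<le> 1"
    by simp_all
  ultimately have "\<xi> \<le> t" "\<xi> \<le> 2 - t"
    using T(1)[of "f 0"] T(1)[of "f 1"] unit by auto
  then show thesis
    using that[OF w'] s str unfolding \<xi>_def by blast
qed

section \<open>Realising the admissible points\<close>

text \<open>Each of the \<open>r\<close> vectors gets weight \<theta> in the second summand and 1 -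
  \<theta> in the third; r \<le> k leaves enough frame vectors for this. The first of them is then
  mixed with \<open>f 0\<close> at weight \<xi>, where \<open>f 0\<close> points in the direction of
  (a, b, c). The last coordinate becomes (r - \<xi>) (2 \<theta> - 1).\<close>

lemma pauli_range_small:
  fixes a b c d :: real
  defines "\<xi> \<equiv> sqrt (a\<^sup>2 + b\<^sup>2 + c\<^sup>2)"
  assumes e: "orthonormal_family {..<k+2+k} e" and r: "0 < r" "r \<le> k"
    and \<xi>: "\<xi> \<le> 1" "\<xi> + \<bar>d\<bar> \<le> real r"
  shows "real_point a b c d \<in> pauli_range e k r"
proof -
  \<comment> \<open>The bound \<bar>d\<bar> \<le> r - \<xi> says precisely that the solution
    \<theta> lies in [0, 1]. If r = \<xi>, then d = 0 and 0 is an arbitrary choice.\<close>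
  obtain \<theta> where \<theta>: "0 \<le> \<theta>" "\<theta> \<le> 1" "d = (real r - \<xi>) * (2 * \<theta> - 1)"
  proof (cases "real r = \<xi>")
    case True
    then show thesis using that[of 0] \<xi> by simp
  next
    case False
    then have pos: "real r - \<xi> > 0" using \<xi>(2) by linarith
    show thesis
    proof (rule that[of "(d / (real r - \<xi>) + 1) / 2"])
      show "0 \<le> (d / (real r - \<xi>) + 1) / 2" "(d / (real r - \<xi>) + 1) / 2 \<le> 1"
        using pos \<xi>(2) by (auto simp: field_simps)
      show "d = (real r - \<xi>) * (2 * ((d / (real r - \<xi>) + 1) / 2) - 1)"
        using pos by (simp add: field_simps)
    qed
  qed
  have \<xi>0: "0 \<le> \<xi>" by (simp add: \<xi>_def)
  obtain a' b' c' where unit: "a'\<^sup>2 + b'\<^sup>2 + c'\<^sup>2 = 1" and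
    abc: "a = \<xi> * a'" "b = \<xi> * b'" "c = \<xi> * c'"
    unfolding \<xi>_def by (rule unit_direction)
  obtain f where f: "orthonormal_family {..<k+2+k} f" and fe: "\<And>i. 2 \<le> i \<Longrightarrow> f i = e i" and
    f0: "pauli_value e k (f 0) = real_point a' b' c' 0"
    using bloch_frame[OF e unit] by metis
  note ee = orthonormal_familyD[OF e] and ff = orthonormal_familyD[OF f]
  have f0e: "cinner (f 0) (e j) = 0" if "2 \<le> j" "j < k + 2 + k" for j
    using that ff[of 0 j] by (simp add: fe)
  have pv: "pauli_value e k (e j) = real_point 0 0 0 (if j < k + 2 then 1 else - 1)"
    if "2 \<le> j" "j < k + 2 + k" for j
    using pauli_value_frame[OF e that] .
  define h where "h l = sqrt \<theta> *\<^sub>R e (l + 2) + sqrt (1 - \<theta>) *\<^sub>R e (l + k + 2)" for l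
  define x where "x l =
      sqrt (if l = 0 then \<xi> else 0) *\<^sub>R f 0 + sqrt (1 - (if l = 0 then \<xi> else 0)) *\<^sub>R h l"
    for l :: nat
  have h: "orthonormal_family {..<r} h"
    unfolding h_def
    by (rule orthonormal_family_mix) (use \<theta> r in \<open>auto simp: orthonormal_family_def ee\<close>)
  have f0h: "cinner (f 0) (h l) = 0" if "l < r" for l
    using that r by (simp add: h_def cinner_add_right cinner_scaleR_right f0e)
  \<comment> \<open>The weight is nonzero at most for \<open>l = 0\<close>, so the constant family
    \<open>f 0\<close> counts as orthonormal where it must.\<close>
  have x: "orthonormal_family {..<r} x"
    unfolding x_def
    by (rule orthonormal_family_mix[OF _ _ h])
      (use \<xi> \<xi>0 f0h r ff[of 0 0] in \<open>auto simp: orthonormal_family_def split: if_splits\<close>)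
  have hv: "pauli_value e k (h l) = real_point 0 0 0 (2 * \<theta> - 1)" if "l < r" for l
    unfolding h_def using that r \<theta>
    by (subst pauli_value_mix) (auto simp: ee pv real_point_scaleR real_point_add)
  have h01: "cinner (h l) (e i) = 0" if "l < r" "i < 2" for l i
    using that r by (simp add: h_def cinner_add_left cinner_scaleR_left ee)
  have xv: "pauli_value e k (x l) = real_point 0 0 0 (2 * \<theta> - 1) +
      (if l = 0 then \<xi> *\<^sub>R real_point a' b' c' (1 - 2 * \<theta>) else 0)" if "l < r" for l
  proof -
    have 1: "cinner (f 0) (e i) = 0 \<or> cinner (h l) (e i) = 0" if "i < k + 2" for i
      using f0e[of i] h01[OF \<open>l < r\<close>, of i] that by (cases "i < 2") auto
    have "pauli_value e k (x l) = (if l = 0 then \<xi> else 0) *\<^sub>R pauli_value e k (f 0) +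
        (1 - (if l = 0 then \<xi> else 0)) *\<^sub>R pauli_value e k (h l)"
      unfolding x_def
      by (rule pauli_value_mix[OF _ _ _ 1]) (use \<xi> \<xi>0 that f0h h01 in auto)
    then show ?thesis
      using that by (simp add: f0 hv real_point_scaleR real_point_add algebra_simps)
  qed
  have "(\<Sum>l<r. pauli_value e k (x l)) =
      real r *\<^sub>R real_point 0 0 0 (2 * \<theta> - 1) + \<xi> *\<^sub>R real_point a' b' c' (1 - 2 * \<theta>)"
    using r by (simp add: xv sum.distrib sum_constant_scaleR del: sum_constant)
  also have "\<dots> = real_point a b c d"
    by (simp add: real_point_scaleR real_point_add real_point_eq_iff abc \<theta>(3) algebra_simps)
  finally show ?thesis
    using pauli_rangeI[OF x sym] by blast
qed

lemma sum_lessThan_if_less: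
  fixes a b :: "'b :: real_vector"
  shows "(\<Sum>l<k+q. if l < k then a else b) = real k *\<^sub>R a + real q *\<^sub>R b"
  by (induction q) (simp_all add: sum_constant_scaleR algebra_simps)

text \<open>A single parameter \<theta> moves all weights linearly: at 0 one has t = \<xi> and s =
  0, the lower bound for d; at 1 one has t = 2 - \<xi> and s = k, the upper bound.\<close>

lemma pauli_range_large:
  fixes a b c d :: real
  defines "\<xi> \<equiv> sqrt (a\<^sup>2 + b\<^sup>2 + c\<^sup>2)"
  assumes e: "orthonormal_family {..<k+2+r} e" and r: "k + 1 < r"
    and \<xi>: "\<xi> \<le> 1" "- real r \<le> d - \<xi>" "d + \<xi> \<le> 2 * real k - real r + 2"
  shows "real_point a b c d \<in> pauli_range e k r"
proof -
  have \<xi>0: "0 \<le> \<xi>" by (simp add: \<xi>_def)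
  \<comment> \<open>The formula interpolates between the extreme values \<xi> - r and 2 k + 2 -
    \<xi> - r of d. They coincide only for k = 0 and \<xi> = 1, and then d equals both.\<close>
  obtain \<theta> where \<theta>: "0 \<le> \<theta>" "\<theta> \<le> 1" "d = \<xi> - real r + \<theta> * (2 * real k + 2 - 2 * \<xi>)"
  proof (cases "2 * real k + 2 - 2 * \<xi> = 0")
    case True
    then show thesis using that[of 0] \<xi> by simp
  next
    case False
    then have pos: "2 * real k + 2 - 2 * \<xi> > 0" using \<xi>(1) by linarith
    show thesis
    proof (rule that[of "(d - \<xi> + real r) / (2 * real k + 2 - 2 * \<xi>)"])
      show "0 \<le> (d - \<xi> + real r) / (2 * real k + 2 - 2 * \<xi>)"
        "(d - \<xi> + real r) / (2 * real k + 2 - 2 * \<xi>) \<le> 1"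
        using pos \<xi> by simp_all
      show "d = \<xi> - real r + (d - \<xi> + real r) / (2 * real k + 2 - 2 * \<xi>) * (2 * real k + 2 - 2 * \<xi>)"
        using False by simp
    qed
  qed
  \<comment> \<open>Weights \<xi> + \<mu> and \<mu> on \<open>f 0\<close> and \<open>f 1\<close>
    keep the Bloch length \<xi> while their sum runs from \<xi> to 2 - \<xi>.\<close>
  define \<mu> where "\<mu> = \<theta> * (1 - \<xi>)"
  have "\<mu> \<le> 1 * (1 - \<xi>)"
    unfolding \<mu>_def using \<theta> \<xi> by (intro mult_right_mono) auto
  then have \<mu>: "0 \<le> \<mu>" "\<xi> + \<mu> \<le> 1"
    using \<theta> \<xi> by (auto simp: \<mu>_def)
  obtain a' b' c' where unit: "a'\<^sup>2 + b'\<^sup>2 + c'\<^sup>2 = 1" and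
    abc: "a = \<xi> * a'" "b = \<xi> * b'" "c = \<xi> * c'"
    unfolding \<xi>_def by (rule unit_direction)
  obtain f where f: "orthonormal_family {..<k+2+r} f" and fe: "\<And>i. 2 \<le> i \<Longrightarrow> f i = e i" and
    f0: "pauli_value e k (f 0) = real_point a' b' c' 0" and
    f1: "pauli_value e k (f 1) = real_point (- a') (- b') (- c') 0"
    using bloch_frame[OF e unit] by metis
  note ee = orthonormal_familyD[OF e] and ff = orthonormal_familyD[OF f]
  \<comment> \<open>The first two slots use the rotated frame, the next \<open>k\<close> the second
    summand. The remaining slots have weight 0 and lie wholly in the third summand.\<close>
  define p where "p l = (if l = 0 then \<xi> + \<mu> else if l = 1 then \<mu> else if l < k + 2 then \<theta> else 0)" for l
  have p: "0 \<le> p l" "p l \<le> 1" for l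
    using \<mu> \<xi>0 \<theta> by (auto simp: p_def)
  define x where "x l = sqrt (p l) *\<^sub>R f l + sqrt (1 - p l) *\<^sub>R e (k + 2 + l)" for l
  have fk: "cinner (f l) (e (k + 2 + j)) = 0" if "l < k + 2" "j < r" for l j
    using that ff[of l "k + 2 + j"] by (simp add: fe)
  have x: "orthonormal_family {..<r} x"
    unfolding x_def
  proof (rule orthonormal_family_mix)
    show "orthonormal_family {i \<in> {..<r}. p i \<noteq> 0} f"
      using r by (intro orthonormal_family_subset[OF f]) auto
    show "orthonormal_family {..<r} (\<lambda>i. e (k + 2 + i))"
      by (auto simp: orthonormal_family_def ee)
    show "cinner (f i) (e (k + 2 + j)) = 0" if "j \<in> {..<r}" "p i \<noteq> 0" for i j
      using that by (intro fk) (auto simp: p_def split: if_splits)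
  qed (use p in auto)
  have ev: "pauli_value e k (e (k + 2 + l)) = real_point 0 0 0 (- 1)" if "l < r" for l
    using pauli_value_frame[OF e, of "k + 2 + l"] that by simp
  have xv: "pauli_value e k (x l) = p l *\<^sub>R pauli_value e k (f l) + real_point 0 0 0 (p l - 1)"
    if "l < r" for l
  proof (cases "l < k + 2")
    case True
    have "pauli_value e k (x l) =
        p l *\<^sub>R pauli_value e k (f l) + (1 - p l) *\<^sub>R pauli_value e k (e (k + 2 + l))"
      unfolding x_def by (rule pauli_value_mix) (use p that True fk in \<open>auto simp: ee\<close>)
    then show ?thesis
      unfolding ev[OF that] real_point_scaleR by simp
  next
    case False
    then show ?thesis
      using ev[OF that] by (simp add: x_def p_def)
  qed
  \<comment> \<open>Besides the two slots of the first summand and the \<open>k\<close> of the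
    second, \<open>q\<close> slots remain; each contributes \<open>- 1\<close> to the last
    coordinate.\<close>
  obtain q where q: "r = (k + q) + 2"
    using r by (metis add.assoc add.commute add_2_eq_Suc' less_iff_Suc_add Suc_eq_plus1 add_Suc_right)
  have xv2: "pauli_value e k (x (l + 2)) = (if l < k then real_point 0 0 0 (2 * \<theta> - 1) else real_point 0 0 0 (- 1))"
    if "l < k + q" for l
    using that q pauli_value_frame[OF e, of "l + 2"]
    by (simp add: xv fe p_def real_point_scaleR real_point_add)
  have "(\<Sum>l<r. pauli_value e k (x l)) = (\<xi> + \<mu>) *\<^sub>R real_point a' b' c' 0 + real_point 0 0 0 (\<xi> + \<mu> - 1)
      + (\<mu> *\<^sub>R real_point (- a') (- b') (- c') 0 + real_point 0 0 0 (\<mu> - 1))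
      + (real k *\<^sub>R real_point 0 0 0 (2 * \<theta> - 1) + real q *\<^sub>R real_point 0 0 0 (- 1))"
    unfolding sum_lessThan_if_less[symmetric] q sum_lessThan_plus2
    using q xv2 xv[of 0] xv[of 1] f0 f1 by (simp add: p_def)
  also have "\<dots> = real_point a b c d"
    unfolding real_point_scaleR real_point_add real_point_eq_iff abc \<theta>(3) \<mu>_def q
    by (simp add: algebra_simps)
  finally show ?thesis
    using pauli_rangeI[OF x sym] by blast
qed

section \<open>The exact regions and their convexity\<close>

lemma convex_bloch_region:
  assumes "\<And>\<xi> d \<xi>' d' \<xi>'' u v. \<lbrakk>P \<xi> d; P \<xi>' d'; 0 \<le> u; 0 \<le> v; u + v = 1;
      0 \<le> \<xi>''; \<xi>'' \<le> u * \<xi> + v * \<xi>'\<rbrakk> \<Longrightarrow> P \<xi>'' (u * d + v * d')"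
  shows "convex {real_point a b c d | a b c d. P (sqrt (a\<^sup>2 + b\<^sup>2 + c\<^sup>2)) d}"
proof (rule convexI, clarify)
  fix u v a b c d a' b' c' d' :: real
  assume uv: "0 \<le> u" "0 \<le> v" "u + v = 1"
    and P: "P (sqrt (a\<^sup>2 + b\<^sup>2 + c\<^sup>2)) d" "P (sqrt (a'\<^sup>2 + b'\<^sup>2 + c'\<^sup>2)) d'"
  have n: "norm (a, b, c) = sqrt (a\<^sup>2 + b\<^sup>2 + c\<^sup>2)" for a b c :: real
    by (simp add: norm_Pair add.assoc)
  have "norm (u *\<^sub>R (a, b, c) + v *\<^sub>R (a', b', c')) \<le> u * norm (a, b, c) + v * norm (a', b', c')"
    using uv by (metis norm_triangle_ineq norm_scaleR abs_of_nonneg)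
  then have "P (sqrt ((u * a + v * a')\<^sup>2 + (u * b + v * b')\<^sup>2 + (u * c + v * c')\<^sup>2)) (u * d + v * d')"
    using uv P by (intro assms[OF P]) (simp_all add: n)
  then show "\<exists>a'' b'' c'' d''. u *\<^sub>R real_point a b c d + v *\<^sub>R real_point a' b' c' d' =
      real_point a'' b'' c'' d'' \<and> P (sqrt (a''\<^sup>2 + b''\<^sup>2 + c''\<^sup>2)) d''"
    unfolding real_point_scaleR real_point_add by blast
qed

text \<open>With d = 2 s + t - r, the bound on d + \<xi> comes from \<xi> \<le> t and s + t \<le> r,
  the bound on \<xi> - d from \<xi> \<le> t and 0 \<le> s.\<close>

lemma pauli_range_small_eq:
  assumes e: "orthonormal_family {..<k+2+k} e" and r: "0 < r" "r \<le> k"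
  shows "pauli_range e k r = {real_point a b c d | a b c d.
    let \<xi> = sqrt (a\<^sup>2 + b\<^sup>2 + c\<^sup>2) in \<xi> \<le> 1 \<and> \<xi> + \<bar>d\<bar> \<le> real r}"
    (is "_ = ?R")
proof
  have e': "orthonormal_family {..<k+2} e"
    using e by (rule orthonormal_family_subset) auto
  show "pauli_range e k r \<subseteq> ?R"
  proof
    fix w assume "w \<in> pauli_range e k r"
    then obtain a b c s t where "w = real_point a b c (2 * s + t - real r)"
      "sqrt (a\<^sup>2 + b\<^sup>2 + c\<^sup>2) \<le> t" "sqrt (a\<^sup>2 + b\<^sup>2 + c\<^sup>2) \<le> 2 - t"
      "0 \<le> s" "s \<le> real k" "s + t \<le> real r"
      by (rule pauli_range_bounds[OF e'])
    then show "w \<in> ?R"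
      unfolding Let_def mem_Collect_eq
      by (intro exI[of _ a] exI[of _ b] exI[of _ c] exI[of _ "2 * s + t - real r"]) linarith
  qed
  show "?R \<subseteq> pauli_range e k r"
    using pauli_range_small[OF e r] by (auto simp: Let_def)
qed

text \<open>Here the upper bound on d + \<xi> comes from s \<le> k and t \<le> 2 - \<xi>, the lower
  bound on d - \<xi> from 0 \<le> s and \<xi> \<le> t.\<close>

lemma pauli_range_large_eq:
  assumes e: "orthonormal_family {..<k+2+r} e" and r: "k + 1 < r"
  shows "pauli_range e k r = {real_point a b c d | a b c d.
    let \<xi> = sqrt (a\<^sup>2 + b\<^sup>2 + c\<^sup>2) in
      \<xi> \<le> 1 \<and> - real r \<le> d - \<xi> \<and> d + \<xi> \<le> 2 * real k - real r + 2}"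
    (is "_ = ?R")
proof
  have e': "orthonormal_family {..<k+2} e"
    using e by (rule orthonormal_family_subset) auto
  show "pauli_range e k r \<subseteq> ?R"
  proof
    fix w assume "w \<in> pauli_range e k r"
    then obtain a b c s t where "w = real_point a b c (2 * s + t - real r)"
      "sqrt (a\<^sup>2 + b\<^sup>2 + c\<^sup>2) \<le> t" "sqrt (a\<^sup>2 + b\<^sup>2 + c\<^sup>2) \<le> 2 - t"
      "0 \<le> s" "s \<le> real k" "s + t \<le> real r"
      by (rule pauli_range_bounds[OF e'])
    then show "w \<in> ?R"
      unfolding Let_def mem_Collect_eq
      by (intro exI[of _ a] exI[of _ b] exI[of _ c] exI[of _ "2 * s + t - real r"]) linarith
  qed
  show "?R \<subseteq> pauli_range e k r"
    using pauli_range_large[OF e r] by (auto simp: Let_def)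
qed

lemma convex_pauli_range_small:
  assumes "orthonormal_family {..<k+2+k} e" "0 < r" "r \<le> k"
  shows "convex (pauli_range e k r)"
  unfolding pauli_range_small_eq[OF assms] Let_def
proof (rule convex_bloch_region)
  fix \<xi> d \<xi>' d' \<xi>'' u v :: real
  assume *: "\<xi> \<le> 1 \<and> \<xi> + \<bar>d\<bar> \<le> real r" "\<xi>' \<le> 1 \<and> \<xi>' + \<bar>d'\<bar> \<le> real r"
    and uv: "0 \<le> u" "0 \<le> v" "u + v = 1" and \<xi>: "\<xi>'' \<le> u * \<xi> + v * \<xi>'"
  have "u * \<xi> + v * \<xi>' \<le> 1" "u * (\<xi> + \<bar>d\<bar>) + v * (\<xi>' + \<bar>d'\<bar>) \<le> real r"
    using * uv by (intro convex_bound_le; simp)+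
  moreover have "\<bar>u * d + v * d'\<bar> \<le> u * \<bar>d\<bar> + v * \<bar>d'\<bar>"
    using uv by (metis abs_triangle_ineq abs_mult abs_of_nonneg)
  ultimately show "\<xi>'' \<le> 1 \<and> \<xi>'' + \<bar>u * d + v * d'\<bar> \<le> real r"
    using \<xi> by (simp add: algebra_simps)
qed

lemma convex_pauli_range_large:
  assumes "orthonormal_family {..<k+2+r} e" "k + 1 < r"
  shows "convex (pauli_range e k r)"
  unfolding pauli_range_large_eq[OF assms] Let_def
proof (rule convex_bloch_region)
  fix \<xi> d \<xi>' d' \<xi>'' u v :: real
  assume *: "\<xi> \<le> 1 \<and> - real r \<le> d - \<xi> \<and> d + \<xi> \<le> 2 * real k - real r + 2"
    "\<xi>' \<le> 1 \<and> - real r \<le> d' - \<xi>' \<and> d' + \<xi>' \<le> 2 * real k - real r + 2"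
    and uv: "0 \<le> u" "0 \<le> v" "u + v = 1" and \<xi>: "\<xi>'' \<le> u * \<xi> + v * \<xi>'"
  \<comment> \<open>The lower bound on d - \<xi> is turned into an upper bound on \<xi> - d, so that
    all three inequalities persist when \<xi> decreases.\<close>
  have "u * \<xi> + v * \<xi>' \<le> 1" "u * (\<xi> - d) + v * (\<xi>' - d') \<le> real r"
    "u * (d + \<xi>) + v * (d' + \<xi>') \<le> 2 * real k - real r + 2"
    using * uv by (intro convex_bound_le; simp)+
  then show "\<xi>'' \<le> 1 \<and> - real r \<le> u * d + v * d' - \<xi>'' \<and>
      u * d + v * d' + \<xi>'' \<le> 2 * real k - real r + 2"
    using \<xi> by (simp add: algebra_simps)
qed

section \<open>Failure of convexity for r = k + 1\<close>

lemma sum_eq_bound_imp_eq: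
  fixes g :: "'i \<Rightarrow> real"
  assumes "finite I" "\<And>i. i \<in> I \<Longrightarrow> g i \<le> C" "(\<Sum>i\<in>I. g i) = real (card I) * C" "i \<in> I"
  shows "g i = C"
proof -
  have "(\<Sum>i\<in>I. C - g i) = 0"
    using assms(3) by (simp add: sum_subtractf)
  then have "\<forall>i\<in>I. C - g i = 0"
    using assms(1,2) by (subst (asm) sum_nonneg_eq_0_iff) auto
  then show ?thesis using assms(4) by simp
qed

text \<open>The point forces equality in all Bessel estimates, so with P the projection onto the
  span of the \<open>x l\<close>, the second summand lies in the range of P and this range lies in
  the span of \<open>e\<close>. The vector v = e 0 - P e 0 is orthogonal to the range of P, yet
  among the frame vectors it pairs nontrivially only with \<open>e 0\<close>. So every
  \<open>x l\<close> is orthogonal to \<open>e 0\<close>, against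
  \<open>T (e 0) = 1 / 2\<close>.\<close>

lemma center_not_in_pauli_range:
  assumes e: "orthonormal_family {..<k+2} e"
  shows "real_point 0 0 0 (real k) \<notin> pauli_range e k (k + 1)"
proof
  assume "real_point 0 0 0 (real k) \<in> pauli_range e k (k + 1)"
  then obtain x where x: "orthonormal_family {..<k+1} x"
    and w: "real_point 0 0 0 (real k) = (\<Sum>l<k+1. pauli_value e k (x l))"
    unfolding pauli_range_def by blast
  define T where "T v = (\<Sum>l<k+1. (cmod (cinner (x l) v))\<^sup>2)" for v
  define s where "s = (\<Sum>i<k. T (e (i + 2)))"
  have st: "s + (T (e 0) + T (e 1)) = (\<Sum>l<k+1. \<Sum>i<k+2. (cmod (cinner (x l) (e i)))\<^sup>2)"
    unfolding sum_lessThan_plus2 sum.distrib s_def T_def sum.swap[of _ "{..<k+1}" "{..<k}"]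
    by (simp only: add.commute)
  have comp: "0 = (\<Sum>l<k+1. 2 * Re (cnj (cinner (x l) (e 0)) * cinner (x l) (e 1)))"
    "0 = (\<Sum>l<k+1. 2 * Im (cnj (cinner (x l) (e 0)) * cinner (x l) (e 1)))"
    "0 = T (e 0) - T (e 1)"
    "real k = 2 * (s + (T (e 0) + T (e 1))) - T (e 0) - T (e 1) - (\<Sum>l<k+1. (norm (x l))\<^sup>2)"
    using w unfolding pauli_value_def real_point_sum real_point_eq_iff st
    by (simp_all only: sum_subtractf sum_distrib_left T_def)
  have norm_x: "(\<Sum>l<k+1. (norm (x l))\<^sup>2) = real k + 1"
    using orthonormal_family_norm[OF x] by simp
  have le: "s + (T (e 0) + T (e 1)) \<le> real k + 1"
    unfolding st norm_x[symmetric] by (intro sum_mono bessel[OF e]) simp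
  have T1: "T (e (i + 2)) \<le> 1" if "i \<in> {..<k}" for i
    using bessel'[OF x, of "e (i + 2)"] orthonormal_family_norm[OF e, of "i + 2"] that
    by (simp add: T_def)
  then have "s \<le> (\<Sum>i<k. 1)"
    unfolding s_def by (rule sum_mono)
  \<comment> \<open>The last coordinate gives 2 s + t = 2 k + 1 for t = T (e 0) + T (e 1); with s +
    t \<le> k + 1 and s \<le> k this leaves s = k and t = 1. The third coordinate splits t
    evenly.\<close>
  then have s: "s = real k" and T0: "T (e 0) = 1 / 2" "T (e 1) = 1 / 2"
    using comp(3,4) le norm_x by simp_all
  have "T (e (i + 2)) = 1" if "i < k" for i
    by (rule sum_eq_bound_imp_eq[of "{..<k}" "\<lambda>i. T (e (i + 2))"]) (use that T1 s s_def in auto)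
  \<comment> \<open>Equality in Bessel against \<open>x\<close>: the vector \<open>e (i + 2)\<close>
    lies in the span of the \<open>x l\<close>.\<close>
  then have Te: "(\<Sum>l<k+1. (cmod (cinner (e (i + 2)) (x l)))\<^sup>2) = (norm (e (i + 2)))\<^sup>2" if "i < k" for i
    using that orthonormal_family_norm[OF e, of "i + 2"]
    unfolding T_def cmod_cinner_commute[of "e (i + 2)"] by simp
  have le1: "(\<Sum>i<k+2. (cmod (cinner (x l) (e i)))\<^sup>2) \<le> 1" if "l < k + 1" for l
    using bessel[OF e finite_lessThan, of "x l"] orthonormal_family_norm[OF x, of l] that by simp
  \<comment> \<open>The total s + t = k + 1 is attained, so each of the k + 1 terms attains its
    bound 1 and each \<open>x l\<close> lies in the span of \<open>e\<close>.\<close>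
  have "(\<Sum>i<k+2. (cmod (cinner (x l) (e i)))\<^sup>2) = 1" if "l < k + 1" for l
    by (rule sum_eq_bound_imp_eq[of "{..<k+1}" "\<lambda>l. \<Sum>i<k+2. (cmod (cinner (x l) (e i)))\<^sup>2"])
      (use that le1 s T0 st in \<open>auto simp del: sum.lessThan_Suc\<close>)
  then have xe: "x l = (\<Sum>i<k+2. cinner (x l) (e i) *\<^sub>C e i)" if "l < k + 1" for l
    using that orthonormal_family_norm[OF x, of l] by (intro bessel_eqD[OF e]) simp_all
  define v where "v = residual {..<k+1} x (e 0)"
  have vx: "cinner v (x l) = 0" if "l < k + 1" for l
    using cinner_residual[OF x] that by (simp add: v_def)
  have ve: "cinner v (e (i + 2)) = 0" if "i < k" for i
    using vx by (subst bessel_eqD[OF x finite_lessThan Te[OF that]])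
      (simp add: cinner_sum_right cinner_scaleC_right del: sum.lessThan_Suc)
  \<comment> \<open>Up to sign this is the cross term of the projection between \<open>e 0\<close>
    and \<open>e 1\<close>; the first two coordinates are twice its real and imaginary
    parts.\<close>
  have v1: "cinner v (e 1) = 0"
  proof -
    have "(\<Sum>l<k+1. cnj (cinner (x l) (e 0)) * cinner (x l) (e 1)) = 0"
      using comp(1,2) unfolding sum_distrib_left[symmetric] complex_eq_iff Re_sum Im_sum by simp
    then show ?thesis
      using orthonormal_familyD[OF e, of 0 1]
      by (simp add: v_def residual_def cinner_diff_left cinner_sum_left cinner_scaleC_left
          del: sum.lessThan_Suc flip: cinner_commute[of "e 0"])
  qed
  have v0: "cinner v (e 0) = 1 / 2"
  proof -
    have "cinner v (e 0) = cinner (e 0) (e 0) - (\<Sum>l<k+1. cinner (e 0) (x l) * cnj (cinner (e 0) (x l)))"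
      unfolding v_def residual_def cinner_diff_left cinner_sum_left cinner_scaleC_left
      by (simp flip: cinner_commute)
    also have "\<dots> = 1 - of_real (T (e 0))"
      using orthonormal_familyD[OF e, of 0 0]
      by (simp add: T_def complex_norm_square[symmetric] cmod_cinner_commute[of "e 0"]
          del: sum.lessThan_Suc)
    finally show ?thesis by (simp add: T0)
  qed
  have "cinner (x l) (e 0) = 0" if "l < k + 1" for l
  proof -
    have "0 = cinner v (\<Sum>i<k+2. cinner (x l) (e i) *\<^sub>C e i)"
      using vx[OF that] xe[OF that] by simp
    also have "\<dots> = cnj (cinner (x l) (e 0)) * (1 / 2)"
      unfolding sum_lessThan_plus2 cinner_add_right cinner_sum_right cinner_scaleC_right
      by (simp add: v0 v1[simplified] ve[simplified])
    finally show ?thesis by simp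
  qed
  then have "T (e 0) = 0"
    unfolding T_def by (intro sum.neutral) auto
  then show False using T0 by simp
qed

lemma pauli_range_not_convex:
  assumes e: "orthonormal_family {..<k+2} e"
  shows "\<not> convex (pauli_range e k (k + 1))"
proof
  assume conv: "convex (pauli_range e k (k + 1))"
  note ee = orthonormal_familyD[OF e]
  have e': "orthonormal_family {..<k+2+0} e"
    using e by simp
  have one: "(\<Sum>i<k+2. (cmod (cinner (e j) (e i)))\<^sup>2) = 1" if "j < 2" for j
    unfolding sum_lessThan_plus2 using that by (cases "j = 0") (auto simp: ee)
  have val: "pauli_value e k (e 0) = real_point 0 0 1 0" "pauli_value e k (e 1) = real_point 0 0 (- 1) 0"
    using one[of 0] one[of 1] orthonormal_family_norm[OF e, of 0] orthonormal_family_norm[OF e, of 1]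
    by (simp_all add: pauli_value_def ee)
  have "real_point 0 0 t (real k) \<in> pauli_range e k (k + 1)"
    if "j < 2" "pauli_value e k (e j) = real_point 0 0 t 0" for j t
  proof (rule pauli_rangeI)
    \<comment> \<open>Slot 0 holds \<open>e j\<close>; the shift by one sends the slots 1, ..., k to
      the indices 2, ..., k + 1 of the second summand.\<close>
    define h where "h l = (if l = 0 then j else l + 1)" for l
    show "orthonormal_family {..<k+1} (\<lambda>l. e (h l))"
      by (rule orthonormal_family_reindex[OF e]) (use that in \<open>auto simp: h_def inj_on_def\<close>)
    have "(\<Sum>l<k+1. pauli_value e k (e (h l))) =
        pauli_value e k (e j) + (\<Sum>l<k. pauli_value e k (e (l + 2)))"
      by (simp add: sum.lessThan_Suc_shift h_def del: sum.lessThan_Suc)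
    also have "(\<Sum>l<k. pauli_value e k (e (l + 2))) = (\<Sum>l<k. real_point 0 0 0 1)"
      by (intro sum.cong) (use pauli_value_frame[OF e'] in auto)
    finally show "real_point 0 0 t (real k) = (\<Sum>l<k+1. pauli_value e k (e (h l)))"
      by (simp add: that sum_constant_scaleR real_point_scaleR real_point_add
          del: sum_constant sum.lessThan_Suc)
  qed
  from this[OF _ val(1)] this[OF _ val(2)]
  have "real_point 0 0 1 (real k) \<in> pauli_range e k (k + 1)"
    "real_point 0 0 (- 1) (real k) \<in> pauli_range e k (k + 1)"
    by simp_all
  from convexD[OF conv this, of "1/2" "1/2"]
  have "real_point 0 0 0 (real k) \<in> pauli_range e k (k + 1)"
    by (simp add: real_point_scaleR real_point_add)
  then show False
    using center_not_in_pauli_range[OF e] by blast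
qed

section \<open>Complementary projections in finite dimension\<close>

text \<open>This is the tuple of traces computed in an arbitrary orthonormal basis \<open>y\<close>:
  the Pauli parts are traceless, and k - (n - k - 2) is the trace of the fourth operator. The first
  two coordinates vanish by expanding \<open>cinner (e 0) (e 1)\<close> in \<open>y\<close>.\<close>

lemma sum_pauli_value_complete:
  fixes e y :: "nat \<Rightarrow> 'a :: complex_hilbert_space"
  assumes dim: "has_hilbert_dim (UNIV :: 'a set) (enat n)"
    and e: "orthonormal_family {..<k+2} e" and y: "orthonormal_family {..<n} y"
  shows "(\<Sum>l<n. pauli_value e k (y l)) = real_point 0 0 0 (2 * real k + 2 - real n)"
proof -
  have one: "(\<Sum>l<n. (cmod (cinner (y l) (e i)))\<^sup>2) = 1" if "i < k + 2" for i
    using norm_residual[OF y finite_lessThan, of "e i"] orthonormal_family_complete[OF dim y, of "e i"]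
      orthonormal_family_norm[OF e, of i] that
    by (simp add: residual_def cmod_cinner_commute[of "e i"])
  have "cinner (e 0) (e 1) = (\<Sum>l<n. cnj (cinner (y l) (e 0)) * cinner (y l) (e 1))"
    by (subst orthonormal_family_complete[OF dim y, of "e 0"])
      (simp add: cinner_sum_left cinner_scaleC_left flip: cinner_commute)
  then have zero: "(\<Sum>l<n. cnj (cinner (y l) (e 0)) * cinner (y l) (e 1)) = 0"
    using orthonormal_familyD[OF e, of 0 1] by simp
  have "(\<Sum>l<n. \<Sum>i<k+2. (cmod (cinner (y l) (e i)))\<^sup>2) = (\<Sum>i<k+2. 1)"
    by (subst sum.swap) (intro sum.cong refl one, simp)
  moreover have "(\<Sum>l<n. (norm (y l))\<^sup>2) = real n"
    using orthonormal_family_norm[OF y] by simp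
  ultimately show ?thesis
    unfolding pauli_value_def real_point_sum real_point_eq_iff sum_subtractf
      sum_distrib_left[symmetric] Re_sum[symmetric] Im_sum[symmetric] zero
    using one[of 0] one[of 1] by simp
qed

text \<open>The family \<open>x\<close> is completed to \<open>n\<close> orthonormal vectors. The
  added n - r vectors give a point of the complementary range, and both partial sums add up to the
  trace.\<close>

lemma pauli_range_complement_subset:
  fixes e :: "nat \<Rightarrow> 'a :: complex_hilbert_space"
  assumes dim: "has_hilbert_dim (UNIV :: 'a set) (enat n)"
    and e: "orthonormal_family {..<k+2} e" and r: "r \<le> n"
  shows "pauli_range e k r \<subseteq>
    (\<lambda>w. real_point 0 0 0 (2 * real k + 2 - real n) - w) ` pauli_range e k (n - r)"
proof
  fix w assume "w \<in> pauli_range e k r"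
  then obtain x where x: "orthonormal_family {..<r} x" and w: "w = (\<Sum>l<r. pauli_value e k (x l))"
    unfolding pauli_range_def by blast
  obtain y where y: "orthonormal_family {..<n} y" and yx: "\<And>i. i < r \<Longrightarrow> y i = x i"
    using orthonormal_extend[OF dim x _ r] by auto
  have "orthonormal_family {..<n - r} (\<lambda>l. y (l + r))"
    by (rule orthonormal_family_reindex[OF y]) auto
  then have "(\<Sum>l<n-r. pauli_value e k (y (l + r))) \<in> pauli_range e k (n - r)"
    by (rule pauli_rangeI) simp
  moreover have "w = real_point 0 0 0 (2 * real k + 2 - real n) - (\<Sum>l<n-r. pauli_value e k (y (l + r)))"
  proof -
    have "(\<Sum>l<n. pauli_value e k (y l)) =
        (\<Sum>l<r. pauli_value e k (y l)) + (\<Sum>l=r..<n. pauli_value e k (y l))"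
      using r by (metis lessThan_atLeast0 sum.atLeastLessThan_concat zero_le)
    also have "(\<Sum>l=r..<n. pauli_value e k (y l)) = (\<Sum>l<n-r. pauli_value e k (y (l + r)))"
      using sum.shift_bounds_nat_ivl[of "\<lambda>l. pauli_value e k (y l)" 0 r "n - r"] r
      by (simp add: lessThan_atLeast0)
    also have "(\<Sum>l<r. pauli_value e k (y l)) = w"
      by (simp add: w yx)
    finally show ?thesis
      unfolding sum_pauli_value_complete[OF dim e y] by (simp add: algebra_simps)
  qed
  ultimately show "w \<in> (\<lambda>w. real_point 0 0 0 (2 * real k + 2 - real n) - w) ` pauli_range e k (n - r)"
    by blast
qed

text \<open>Reflection in a point is an involution, so the reverse inclusion is the previous one
  applied to n - r.\<close>

lemma pauli_range_complement:
  fixes e :: "nat \<Rightarrow> 'a :: complex_hilbert_space"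
  assumes dim: "has_hilbert_dim (UNIV :: 'a set) (enat n)"
    and e: "orthonormal_family {..<k+2} e" and r: "r \<le> n"
  shows "pauli_range e k r =
    (\<lambda>w. real_point 0 0 0 (2 * real k + 2 - real n) - w) ` pauli_range e k (n - r)"
  using pauli_range_complement_subset[OF dim e r]
    pauli_range_complement_subset[OF dim e, of "n - r"] r
  by (force simp: subset_iff image_iff)

lemma convex_reflection_iff:
  "convex ((\<lambda>w. p - w) ` S) \<longleftrightarrow> convex S"
  for S :: "'b :: real_vector set"
proof -
  have "(\<lambda>w. p - w) ` S = (+) p ` uminus ` S"
    by (simp add: image_image)
  then have "convex ((\<lambda>w. p - w) ` S) \<longleftrightarrow> convex (uminus ` S)"
    by (simp only: convex_translation_eq)
  also have "\<dots> \<longleftrightarrow> convex S"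
    using convex_negations[of S] convex_negations[of "uminus ` S"] by (auto simp: image_image)
  finally show ?thesis .
qed

lemma convex_pauli_range_0: "convex (pauli_range e k 0)"
proof -
  have "pauli_range e k 0 = {0}"
    by (auto simp: pauli_range_def orthonormal_family_def)
  then show ?thesis by simp
qed

section \<open>From the direct sums to coordinates\<close>

lemma joint_numerical_range_eq_pauli_range:
  assumes "\<And>v. (\<chi> j. cinner (A j v) v) = pauli_value e k v"
  shows "joint_numerical_range r A = pauli_range e k r"
proof -
  have "(\<chi> j. \<Sum>l<r. cinner (A j (x l)) (x l)) = (\<Sum>l<r. pauli_value e k (x l))" for x
    unfolding assms[symmetric] by (simp add: vec_eq_iff)
  then show ?thesis
    by (simp add: joint_numerical_range_def pauli_range_def)
qed

lemma cinner_matrix_operator: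
  fixes M :: "complex^2^2"
  shows "cinner (matrix_operator M u x) v =
    (M $ 1 $ 1 * cinner x (u 1) + M $ 1 $ 2 * cinner x (u 2)) * cnj (cinner v (u 1)) +
    (M $ 2 $ 1 * cinner x (u 1) + M $ 2 $ 2 * cinner x (u 2)) * cnj (cinner v (u 2))"
  by (simp add: matrix_operator_def sum_2 cinner_add_left cinner_scaleC_left
      flip: cinner_commute)

text \<open>The frame consists of the given basis \<open>u\<close> of the first summand followed by
  an enumerated basis of the second. The part of a vector in the third summand is recovered from the
  norm by Pythagoras.\<close>

lemma pauli_coordinates:
  fixes u :: "2 \<Rightarrow> 'a :: complex_hilbert_space"
  assumes decomposition: "orthogonal_decomposition H1 H2 H3"
    and H2: "has_hilbert_dim H2 (enat k)"
    and basis: "orthonormal_basis UNIV u H1"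
    and A1: "is_direct_sum H1 H2 H3 (A 1) (matrix_operator pauli_X u) (\<lambda>_. 0) (\<lambda>_. 0)"
    and A2: "is_direct_sum H1 H2 H3 (A 2) (matrix_operator pauli_Y u) (\<lambda>_. 0) (\<lambda>_. 0)"
    and A3: "is_direct_sum H1 H2 H3 (A 3) (matrix_operator pauli_Z u) (\<lambda>_. 0) (\<lambda>_. 0)"
    and A4: "is_direct_sum H1 H2 H3 (A 4) (\<lambda>_. 0) (\<lambda>y. y) (\<lambda>z. - z)"
  obtains e where "orthonormal_family {..<k+2} e" "\<And>v. (\<chi> j. cinner (A j v) v) = pauli_value e k v"
proof -
  have orth: "\<And>x y. x \<in> H1 \<Longrightarrow> y \<in> H2 \<Longrightarrow> cinner x y = 0" "\<And>x z. x \<in> H1 \<Longrightarrow> z \<in> H3 \<Longrightarrow> cinner x z = 0"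
    "\<And>y z. y \<in> H2 \<Longrightarrow> z \<in> H3 \<Longrightarrow> cinner y z = 0"
    using decomposition by (auto simp: orthogonal_decomposition_def)
  then have orth': "\<And>x y. x \<in> H1 \<Longrightarrow> y \<in> H2 \<Longrightarrow> cinner y x = 0" "\<And>x z. x \<in> H1 \<Longrightarrow> z \<in> H3 \<Longrightarrow> cinner z x = 0"
    "\<And>y z. y \<in> H2 \<Longrightarrow> z \<in> H3 \<Longrightarrow> cinner z y = 0"
    by (metis cinner_eq_0_commute)+
  obtain B where B: "orthonormal_basis B (\<lambda>b. b) H2" "finite B" "card B = k"
    using H2 by (auto simp: has_hilbert_dim_def split: if_splits)
  have on: "orthonormal_family UNIV u" "orthonormal_family B (\<lambda>b. b)"
    using basis B(1) by (simp_all add: orthonormal_basis_def)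
  have BH: "b \<in> H2" if "b \<in> B" for b
    using B(1) that closure_subset complex_vector.span_superset
    unfolding orthonormal_basis_def by fastforce
  have uH: "u i \<in> H1" for i
    using basis closure_subset complex_vector.span_superset
    unfolding orthonormal_basis_def by fastforce
  obtain h where h: "bij_betw h {..<k} B"
    using ex_bij_betw_nat_finite[OF B(2)] B(3) by (auto simp: lessThan_atLeast0)
  have hB: "h i \<in> B" if "i < k" for i
    using h that by (auto dest: bij_betwE)
  have hinj: "h i = h j \<longleftrightarrow> i = j" if "i < k" "j < k" for i j
    using h that by (auto simp: bij_betw_def inj_on_def)
  define e where "e i = (if i = 0 then u 1 else if i = 1 then u 2 else h (i - 2))" for i :: nat
  have e: "e 0 = u 1" "e 1 = u 2" "\<And>i. e (i + 2) = h i"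
    by (simp_all add: e_def)
  show thesis
  proof (rule that)
    show "orthonormal_family {..<k+2} e"
      unfolding orthonormal_family_def
    proof (intro ballI)
      fix i j assume "i \<in> {..<k+2}" "j \<in> {..<k+2}"
      then show "cinner (e i) (e j) = (if i = j then 1 else 0)"
        by (auto simp: e_def orthonormal_familyD[OF on(1)] orthonormal_familyD[OF on(2)]
            orth orth' uH BH hB hinj)
    qed
  next
    fix v
    obtain x y z where xyz: "x \<in> H1" "y \<in> H2" "z \<in> H3" and v: "v = x + y + z"
      using decomposition unfolding orthogonal_decomposition_def by metis
    have vu: "cinner v (u i) = cinner x (u i)" for i
      using xyz uH by (simp add: v cinner_add_left orth')
    have vh: "cinner v (h i) = cinner y (h i)" if "i < k" for i
      using xyz BH[OF hB[OF that]] by (simp add: v cinner_add_left orth orth')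
    have A: "A 1 v = matrix_operator pauli_X u x" "A 2 v = matrix_operator pauli_Y u x"
      "A 3 v = matrix_operator pauli_Z u x" "A 4 v = y - z"
      using A1 A2 A3 A4 xyz by (simp_all add: v is_direct_sum_def)
    have nv: "(norm v)\<^sup>2 = (norm x)\<^sup>2 + (norm y)\<^sup>2 + (norm z)\<^sup>2"
      using xyz by (simp add: v norm_add_orthogonal cinner_add_left orth)
    have nx: "(norm x)\<^sup>2 = (cmod (cinner x (u 1)))\<^sup>2 + (cmod (cinner x (u 2)))\<^sup>2"
      using parseval[OF basis finite xyz(1)] by (simp add: sum_2)
    have ny: "(\<Sum>i<k. (cmod (cinner v (h i)))\<^sup>2) = (norm y)\<^sup>2"
    proof -
      have "(\<Sum>i<k. (cmod (cinner v (h i)))\<^sup>2) = (\<Sum>b\<in>B. (cmod (cinner y b))\<^sup>2)"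
        using vh by (intro sum.reindex_bij_betw[OF h, THEN trans[rotated]] sum.cong) simp_all
      then show ?thesis
        using parseval[OF B(1,2) xyz(2)] by simp
    qed
    have "cinner (A 4 v) v = of_real ((norm y)\<^sup>2 - (norm z)\<^sup>2)"
      unfolding A using xyz by (simp add: v cinner_diff_left cinner_add_right orth orth' cinner_self)
    \<comment> \<open>By Pythagoras and Parseval the left side is 2 (|x|^2 + |y|^2) - |x|^2 - (|x|^2
      + |y|^2 + |z|^2).\<close>
    moreover have "2 * (\<Sum>i<k+2. (cmod (cinner v (e i)))\<^sup>2)
        - (cmod (cinner v (e 0)))\<^sup>2 - (cmod (cinner v (e 1)))\<^sup>2 - (norm v)\<^sup>2 = (norm y)\<^sup>2 - (norm z)\<^sup>2"
      unfolding sum_lessThan_plus2 e ny vu nv nx by simp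
    moreover have "cinner (A 1 v) v = of_real (2 * Re (cnj (cinner v (u 1)) * cinner v (u 2)))"
      unfolding A cinner_matrix_operator vu
      by (simp add: pauli_X_def complex_eq_iff algebra_simps)
    moreover have "cinner (A 2 v) v = of_real (2 * Im (cnj (cinner v (u 1)) * cinner v (u 2)))"
      unfolding A cinner_matrix_operator vu
      by (simp add: pauli_Y_def complex_eq_iff algebra_simps)
    moreover have "cinner (A 3 v) v = of_real ((cmod (cinner v (u 1)))\<^sup>2 - (cmod (cinner v (u 2)))\<^sup>2)"
      unfolding A cinner_matrix_operator vu cmod_power2
      by (simp add: pauli_Z_def complex_eq_iff power2_eq_square)
    ultimately show "(\<chi> j. cinner (A j v) v) = pauli_value e k v"
      unfolding pauli_value_def vec_eq_iff forall_4 real_point_nth e by simp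
  qed
qed

section \<open>Assembling the cases of r\<close>

theorem mainTheorem9:
  fixes k :: nat and N :: enat
    and H1 H2 H3 :: "'a :: complex_hilbert_space set"
    and u :: "2 \<Rightarrow> 'a" and A :: "4 \<Rightarrow> 'a \<Rightarrow> 'a"
  assumes dim_H: "has_hilbert_dim (UNIV :: 'a set) N"
    and N_ge: "N \<ge> enat (2 * (k + 1))"
    and decomposition: "orthogonal_decomposition H1 H2 H3"
    and dims: "has_hilbert_dim H1 2" "has_hilbert_dim H2 (enat k)"
      "has_hilbert_dim H3 (N - enat k - 2)"
    and basis: "orthonormal_basis UNIV u H1"
    and A1: "is_direct_sum H1 H2 H3 (A 1) (matrix_operator pauli_X u) (\<lambda>_. 0) (\<lambda>_. 0)"
    and A2: "is_direct_sum H1 H2 H3 (A 2) (matrix_operator pauli_Y u) (\<lambda>_. 0) (\<lambda>_. 0)"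
    and A3: "is_direct_sum H1 H2 H3 (A 3) (matrix_operator pauli_Z u) (\<lambda>_. 0) (\<lambda>_. 0)"
    and A4: "is_direct_sum H1 H2 H3 (A 4) (\<lambda>_. 0) (\<lambda>y. y) (\<lambda>z. - z)"
  shows "\<not> convex (joint_numerical_range (k + 1) A) \<and>
    (\<forall>r::nat. 0 < r \<and> enat r \<le> N \<longrightarrow>
      (r \<le> k \<longrightarrow>
        convex (joint_numerical_range r A) \<and>
        joint_numerical_range r A =
          {real_point a b c d | a b c d.
             let \<xi> = sqrt (a\<^sup>2 + b\<^sup>2 + c\<^sup>2) in \<xi> \<le> 1 \<and> \<xi> + \<bar>d\<bar> \<le> real r}) \<and>
      (k + 1 < r \<and> enat (2 * r) \<le> N \<longrightarrow>
        convex (joint_numerical_range r A) \<and>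
        joint_numerical_range r A =
          {real_point a b c d | a b c d.
             let \<xi> = sqrt (a\<^sup>2 + b\<^sup>2 + c\<^sup>2) in
               \<xi> \<le> 1 \<and> - real r \<le> d - \<xi> \<and> d + \<xi> \<le> 2 * real k - real r + 2}) \<and>
      (\<forall>n::nat. N = enat n \<and> real r \<ge> real n / 2 \<longrightarrow>
        joint_numerical_range r A =
          (\<lambda>w. real_point 0 0 0 (2 * real k + 2 - real n) - w) ` joint_numerical_range (n - r) A \<and>
        (convex (joint_numerical_range r A) \<longleftrightarrow> r \<noteq> n - k - 1)))"
proof -
  obtain e where e: "orthonormal_family {..<k+2} e"
    and val: "\<And>v. (\<chi> j. cinner (A j v) v) = pauli_value e k v"
    using pauli_coordinates[OF decomposition dims(2) basis A1 A2 A3 A4] by blast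
  note W = joint_numerical_range_eq_pauli_range[OF val]
  \<comment> \<open>Adding \<open>m\<close> frame vectors leaves the range unchanged, since its
    definition involves only the first \<open>k + 2\<close>; they supply the directions of the third
    summand used for realisation.\<close>
  have ext: "\<exists>e' :: nat \<Rightarrow> 'a. orthonormal_family {..<k+2+m} e' \<and> pauli_range e k = pauli_range e' k"
    if m: "enat (k + 2 + m) \<le> N" for m
  proof -
    obtain e' where e': "orthonormal_family {..<k+2+m} e'" "\<And>i. i < k + 2 \<Longrightarrow> e' i = e i"
      using orthonormal_extend[OF dim_H e m] by auto
    then have "pauli_range e k = pauli_range e' k"
      unfolding pauli_range_def using pauli_value_cong[of k e e'] by simp
    then show ?thesis
      using e'(1) by blast
  qed
  have "enat (k + 2 + k) \<le> N"
    using N_ge by (simp add: mult_2)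
  then obtain e1 :: "nat \<Rightarrow> 'a" where e1: "orthonormal_family {..<k+2+k} e1" "pauli_range e k = pauli_range e1 k"
    using ext[of k] by blast
  have large: "\<exists>e2 :: nat \<Rightarrow> 'a. orthonormal_family {..<k+2+r} e2 \<and> pauli_range e k = pauli_range e2 k"
    if "k + 1 < r" "enat (2 * r) \<le> N" for r
  proof (rule ext)
    have "enat (k + 2 + r) \<le> enat (2 * r)"
      using that(1) by simp
    then show "enat (k + 2 + r) \<le> N"
      using that(2) by (rule order_trans)
  qed
  \<comment> \<open>The case r = 0 is included because the complement of a full orthonormal basis is
    empty.\<close>
  have convex_iff: "convex (pauli_range e k r) \<longleftrightarrow> r \<noteq> k + 1" if le: "enat (2 * r) \<le> N" for r
  proof -
    consider "r = 0" | "0 < r" "r \<le> k" | "r = k + 1" | "k + 1 < r" by linarith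
    then show ?thesis
    proof cases
      case 1
      then show ?thesis by (simp add: convex_pauli_range_0)
    next
      case 2
      then show ?thesis using convex_pauli_range_small[OF e1(1), of r] e1(2) by simp
    next
      case 3
      then show ?thesis using pauli_range_not_convex[OF e] by simp
    next
      case 4
      obtain e2 :: "nat \<Rightarrow> 'a"
        where "orthonormal_family {..<k+2+r} e2" "pauli_range e k = pauli_range e2 k"
        using large[OF 4 le] by blast
      then show ?thesis
        using convex_pauli_range_large[of k r e2] 4 by simp
    qed
  qed
  show ?thesis
    unfolding W
  proof (intro conjI allI impI; (elim conjE)?)
    show "\<not> convex (pauli_range e k (k + 1))"
      by (rule pauli_range_not_convex[OF e])
  next
    fix r :: nat assume r: "0 < r" "r \<le> k"
    show "convex (pauli_range e k r)"
      using convex_pauli_range_small[OF e1(1) r] e1(2) by simp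
    show "pauli_range e k r = {real_point a b c d | a b c d.
        let \<xi> = sqrt (a\<^sup>2 + b\<^sup>2 + c\<^sup>2) in \<xi> \<le> 1 \<and> \<xi> + \<bar>d\<bar> \<le> real r}"
      using pauli_range_small_eq[OF e1(1) r] e1(2) by simp
  next
    fix r :: nat assume r: "k + 1 < r" "enat (2 * r) \<le> N"
    show "convex (pauli_range e k r)"
      using convex_iff[OF r(2)] r(1) by simp
    obtain e2 :: "nat \<Rightarrow> 'a"
      where e2: "orthonormal_family {..<k+2+r} e2" "pauli_range e k = pauli_range e2 k"
      using large[OF r] by blast
    show "pauli_range e k r = {real_point a b c d | a b c d.
        let \<xi> = sqrt (a\<^sup>2 + b\<^sup>2 + c\<^sup>2) in
          \<xi> \<le> 1 \<and> - real r \<le> d - \<xi> \<and> d + \<xi> \<le> 2 * real k - real r + 2}"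
      unfolding e2(2) by (rule pauli_range_large_eq[OF e2(1) r(1)])
  next
    fix r n :: nat
    assume r: "0 < r" "enat r \<le> N" and n: "N = enat n" "real n / 2 \<le> real r"
    have dim: "has_hilbert_dim (UNIV :: 'a set) (enat n)"
      using dim_H n by simp
    have rn: "r \<le> n" "n \<le> 2 * r" and nk: "2 * (k + 1) \<le> n"
      using r n N_ge by simp_all
    show eq: "pauli_range e k r =
        (\<lambda>w. real_point 0 0 0 (2 * real k + 2 - real n) - w) ` pauli_range e k (n - r)"
      by (rule pauli_range_complement[OF dim e rn(1)])
    \<comment> \<open>From n \<le> 2 r follows 2 (n - r) \<le> n, so the criterion applies to the
      complementary range.\<close>
    have "convex (pauli_range e k r) \<longleftrightarrow> n - r \<noteq> k + 1"
      unfolding eq convex_reflection_iff using rn n by (intro convex_iff) simp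
    also have "n - r \<noteq> k + 1 \<longleftrightarrow> r \<noteq> n - k - 1"
      using rn nk by auto
    finally show "convex (pauli_range e k r) \<longleftrightarrow> r \<noteq> n - k - 1" .
  qed
qed

end
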